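(* Let $d\ge 1$ be an integer and, for $m\ge 1$, let $\mathbf d^{(m)}=(d,d,\dots,d)$ have length $m$. Let $\mathrm T^{(1)}$ be the unique element of $\mathcal T_{\mathbf d^{(1)}}$, and for each $m\ge 1$ let $\mathrm T^{(m+1)}$ be the output of the growth procedure applied to $\mathrm T^{(m)}$ and a uniformly random multiset of $d$ vertices of $\mathrm T^{(m)}$, chosen independently of all previous choices. Let $\mathrm T_m$ be obtained from $\mathrm T^{(m)}$ by forgetting the labels of the non-leaf vertices. Then for every $m\ge 1$: (i) $\mathrm T_m$ is a uniformly random leaf-labeled $d$-ary tree with $m$ internal nodes; (ii) given $\mathrm T_{m+1}$, the non-leaf vertex that was added in order to obtain $\mathrm T_{m+1}$ from $\mathrm T_m$ (that is, the vertex labeled $m+1$ in $\mathrm T^{(m+1)}$) is a uniformly random non-leaf vertex of $\mathrm T_{m+1}$.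
   Context: Write $[m]=\{1,\dots,m\}$, and fix an abstract set $\{\ell_i : i\ge 1\}$ of distinct leaf labels, disjoint from the integers. For a finite sequence $\mathbf d=(d_1,\dots,d_m)$ of positive integers let $L_{\mathbf d}=1+\sum_{i=1}^m(d_i-1)$. Let $\mathcal T_{\mathbf d}$ be the set of rooted trees (with no planar order on children) with vertex set $[m]\cup\{\ell_1,\dots,\ell_{L_{\mathbf d}}\}$ such that each $i\in[m]$ has exactly $d_i$ children and each $\ell_i$ is a leaf (has no children). A leaf-labeled $d$-ary tree with $m$ internal nodes is a rooted (non-planar) tree with $m$ non-leaf vertices, each having exactly $d$ children, whose $1+m(d-1)$ leaves are labeled bijectively by $\ell_1,\dots,\ell_{1+m(d-1)}$ and whose non-leaf vertices are unlabeled; two such trees are identified if there is a root-preserving graph isomorphism between them which preserves leaf labels. Total order $\preceq$ on the vertices of $T\in\mathcal T_{\mathbf d}$ with root $\rho$: let $S_0=\{\rho\}$; for $i=1,\dots,L_{\mathbf d}$ let $P_i$ be the unique path in $T$ that starts at a vertex of $S_{i-1}$, visits no other vertex of $S_{i-1}$, and ends at $\ell_i$, and let $S_i=S_{i-1}\cup P_i$. Then $\preceq$ is the order in which the vertices first appear when the paths $P_1,P_2,\dots,P_{L_{\mathbf d}}$ are read one after the other, each from its starting point to its endpoint $\ell_i$. Growth procedure (from $\mathcal T_{\mathbf d}$, $\mathbf d=(d_1,\dots,d_m)$, to $\mathcal T_{\mathbf d'}$, $\mathbf d'=(d_1,\dots,d_m,d)$): the input is $T\in\mathcal T_{\mathbf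 d}$ and a multiset $\{w_1,\dots,w_d\}$ of $d$ vertices of $T$, listed so that $w_1\preceq w_2\preceq\dots\preceq w_d$. Add new vertices $m+1,\ell_{L_{\mathbf d}+1},\dots,\ell_{L_{\mathbf d}+d-1}$ to $T$ and modify the edges as follows. (1) If $w_1$ is the root of $T$, connect $m+1$ to $w_1$ and re-root the tree at $m+1$. Otherwise, replace the edge $vw_1$ joining $w_1$ to its parent $v$ by the two edges $v(m+1)$ and $(m+1)w_1$. (2) For $j=2,\dots,d$ successively: (a) if $w_j=w_{j-1}$, add an edge from $m+1$ to $\ell_{L_{\mathbf d}+j-1}$ (so that it is a child of $m+1$); (b) if $w_j\ne w_{j-1}$, remove the edge from $w_j$ to its parent $v$, then add an edge from $v$ to $\ell_{L_{\mathbf d}+j-1}$ and an edge from $m+1$ to $w_j$ (so that $\ell_{L_{\mathbf d}+j-1}$ becomes a child of $v$ and $w_j$ becomes a child of $m+1$). The output is the resulting rooted tree. "Uniformly random multiset of $d$ vertices" means uniform over the set of all multisets of size $d$ (repetitions allowed, order ignored) of vertices. *)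

theory Defs
  imports "HOL-Probability.Probability"
begin

text \<open>
  A rooted tree is represented with every edge directed away from the root: \<open>(u, v) \<in> tarcs T\<close>
  means that \<open>u\<close> is the parent of \<open>v\<close>.
\<close>

record 'v rtree =
  tverts :: "'v set"
  troot :: 'v
  tarcs :: "('v \<times> 'v) set"

definition rooted_tree :: "'v rtree \<Rightarrow> bool" where
  "rooted_tree T \<longleftrightarrow>
     finite (tverts T) \<and> troot T \<in> tverts T \<and> tarcs T \<subseteq> tverts T \<times> tverts T \<and>
     (\<forall>u. (u, troot T) \<notin> tarcs T) \<and>
     (\<forall>v \<in> tverts T - {troot T}. \<exists>!u. (u, v) \<in> tarcs T) \<and>
     (\<forall>v \<in> tverts T. (troot T, v) \<in> (tarcs T)\<^sup>*)"

definition parent :: "'v rtree \<Rightarrow> 'v \<Rightarrow> 'v" where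
  "parent T v = (THE u. (u, v) \<in> tarcs T)"

definition children :: "'v rtree \<Rightarrow> 'v \<Rightarrow> 'v set" where
  "children T v = {w. (v, w) \<in> tarcs T}"

definition leaves :: "'v rtree \<Rightarrow> 'v set" where
  "leaves T = {v \<in> tverts T. children T v = {}}"

definition nonleaves :: "'v rtree \<Rightarrow> 'v set" where
  "nonleaves T = {v \<in> tverts T. children T v \<noteq> {}}"

definition adjacent :: "'v rtree \<Rightarrow> 'v \<Rightarrow> 'v \<Rightarrow> bool" where
  "adjacent T u v \<longleftrightarrow> (u, v) \<in> tarcs T \<or> (v, u) \<in> tarcs T"

definition tree_path :: "'v rtree \<Rightarrow> 'v list \<Rightarrow> bool" where
  "tree_path T xs \<longleftrightarrow>
     xs \<noteq> [] \<and> set xs \<subseteq> tverts T \<and> distinct xs \<and> successively (adjacent T) xs"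

datatype vertex = Node nat | Leaf nat

text \<open>\<open>Leaf i\<close> is the leaf label $\ell_i$; degree sequences $(d_1,\dots,d_m)$ are lists,
  so that $d_i$ is \<open>ds ! (i - 1)\<close>.\<close>

definition num_leaves :: "nat list \<Rightarrow> nat" where
  "num_leaves ds = 1 + (\<Sum>d\<leftarrow>ds. d - 1)"

definition labeled_trees :: "nat list \<Rightarrow> vertex rtree set" where
  "labeled_trees ds =
     {T. rooted_tree T \<and>
         tverts T = Node ` {1..length ds} \<union> Leaf ` {1..num_leaves ds} \<and>
         (\<forall>i \<in> {1..length ds}. card (children T (Node i)) = ds ! (i - 1)) \<and>
         (\<forall>i \<in> {1..num_leaves ds}. children T (Leaf i) = {})}"

definition branch_path :: "vertex rtree \<Rightarrow> vertex set \<Rightarrow> nat \<Rightarrow> vertex list" where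
  "branch_path T S i =
     (THE xs. tree_path T xs \<and> hd xs \<in> S \<and> set (tl xs) \<inter> S = {} \<and> last xs = Leaf i)"

text \<open>\<open>spanned T i\<close> is $S_i$, and \<open>reading T i\<close> is the concatenation of $P_1,\dots,P_i$.\<close>

fun spanned :: "vertex rtree \<Rightarrow> nat \<Rightarrow> vertex set" where
  "spanned T 0 = {troot T}"
| "spanned T (Suc i) = spanned T i \<union> set (branch_path T (spanned T i) (Suc i))"

definition reading :: "vertex rtree \<Rightarrow> nat \<Rightarrow> vertex list" where
  "reading T n = concat (map (\<lambda>i. branch_path T (spanned T (i - 1)) i) [1..<Suc n])"

definition first_pos :: "'a list \<Rightarrow> 'a \<Rightarrow> nat" where
  "first_pos xs v = (LEAST k. k < length xs \<and> xs ! k = v)"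

definition vertex_le :: "nat list \<Rightarrow> vertex rtree \<Rightarrow> vertex \<Rightarrow> vertex \<Rightarrow> bool" where
  "vertex_le ds T v w \<longleftrightarrow>
     first_pos (reading T (num_leaves ds)) v \<le> first_pos (reading T (num_leaves ds)) w"

definition sorted_listing :: "nat list \<Rightarrow> vertex rtree \<Rightarrow> vertex multiset \<Rightarrow> vertex list" where
  "sorted_listing ds T W = (THE ws. mset ws = W \<and> sorted_wrt (vertex_le ds T) ws)"

definition insert_above :: "vertex \<Rightarrow> vertex \<Rightarrow> vertex rtree \<Rightarrow> vertex rtree" where
  "insert_above x w T =
     (if w = troot T
      then T\<lparr>troot := x, tarcs := insert (x, w) (tarcs T)\<rparr>
      else let v = parent T w
           in T\<lparr>tarcs := (tarcs T - {(v, w)}) \<union> {(v, x), (x, w)}\<rparr>)"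

definition move_below :: "vertex \<Rightarrow> vertex \<Rightarrow> vertex \<Rightarrow> vertex rtree \<Rightarrow> vertex rtree" where
  "move_below x w l T =
     (let v = parent T w
      in T\<lparr>tarcs := (tarcs T - {(v, w)}) \<union> {(v, l), (x, w)}\<rparr>)"

text \<open>\<open>growth_step x L ws j\<close> is step (2) of the procedure for the index \<open>j\<close>, where \<open>x\<close> is the new
  non-leaf vertex, \<open>L\<close> the previous number of leaves, and $w_j$ is \<open>ws ! (j - 1)\<close>.\<close>

definition growth_step ::
    "vertex \<Rightarrow> nat \<Rightarrow> vertex list \<Rightarrow> nat \<Rightarrow> vertex rtree \<Rightarrow> vertex rtree" where
  "growth_step x L ws j T =
     (let l = Leaf (L + j - 1)
      in if ws ! (j - 1) = ws ! (j - 2)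
         then T\<lparr>tarcs := insert (x, l) (tarcs T)\<rparr>
         else move_below x (ws ! (j - 1)) l T)"

definition grow :: "nat list \<Rightarrow> vertex rtree \<Rightarrow> vertex multiset \<Rightarrow> vertex rtree" where
  "grow ds T W =
     (let d = size W;
          L = num_leaves ds;
          ws = sorted_listing ds T W;
          x = Node (length ds + 1);
          T0 = T\<lparr>tverts := tverts T \<union> {x} \<union> Leaf ` {L + 1..L + d - 1}\<rparr>
      in fold (growth_step x L ws) [2..<d + 1] (insert_above x (ws ! 0) T0))"

text \<open>
  \<open>growth_law d m\<close> is the law of the Markov chain of trees at time \<open>m\<close>. The chain starts at
  \<open>m = 1\<close>; the value at \<open>0\<close> (the tree with the single vertex $\ell_1$) is only a convention.
\<close>

fun growth_law :: "nat \<Rightarrow> nat \<Rightarrow> vertex rtree pmf" where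
  "growth_law d 0 = return_pmf (the_elem (labeled_trees []))"
| "growth_law d (Suc 0) = return_pmf (the_elem (labeled_trees [d]))"
| "growth_law d (Suc (Suc n)) =
     bind_pmf (growth_law d (Suc n)) (\<lambda>T.
       map_pmf (grow (replicate (Suc n) d) T)
         (pmf_of_set (multisets_of_size (tverts T) d)))"

text \<open>
  A tree with labeled leaves is a pair of a rooted tree and a labeling; only the values of the
  labeling on the leaves matter, and the label $\ell_i$ is given by its index \<open>i\<close>.
\<close>

definition leaf_isomorphism ::
    "('v \<Rightarrow> 'w) \<Rightarrow> 'v rtree \<times> ('v \<Rightarrow> nat) \<Rightarrow> 'w rtree \<times> ('w \<Rightarrow> nat) \<Rightarrow> bool" where
  "leaf_isomorphism \<phi> X Y \<longleftrightarrow>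
     bij_betw \<phi> (tverts (fst X)) (tverts (fst Y)) \<and>
     (\<forall>u \<in> tverts (fst X). \<forall>v \<in> tverts (fst X).
        adjacent (fst X) u v \<longleftrightarrow> adjacent (fst Y) (\<phi> u) (\<phi> v)) \<and>
     \<phi> (troot (fst X)) = troot (fst Y) \<and>
     (\<forall>v \<in> leaves (fst X). snd Y (\<phi> v) = snd X v)"

definition dary_representatives :: "nat \<Rightarrow> nat \<Rightarrow> ('v rtree \<times> ('v \<Rightarrow> nat)) set" where
  "dary_representatives d m =
     {(T, lab). rooted_tree T \<and>
        card (nonleaves T) = m \<and>
        (\<forall>v \<in> nonleaves T. card (children T v) = d) \<and>
        bij_betw lab (leaves T) {1..1 + m * (d - 1)}}"

definition leaf_iso_rel ::
    "nat \<Rightarrow> nat \<Rightarrow> (('v rtree \<times> ('v \<Rightarrow> nat)) \<times> ('v rtree \<times> ('v \<Rightarrow> nat))) set" where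
  "leaf_iso_rel d m =
     {(X, Y). X \<in> dary_representatives d m \<and> Y \<in> dary_representatives d m \<and>
        (\<exists>\<phi>. leaf_isomorphism \<phi> X Y)}"

text \<open>
  A leaf-labeled d-ary tree is an isomorphism class. Representatives range over trees on
  subsets of the infinite type \<open>vertex\<close>, where the names of the vertices carry no meaning.
\<close>

type_synonym leaf_labeled_tree = "(vertex rtree \<times> (vertex \<Rightarrow> nat)) set"

definition leaf_labeled_dary_trees :: "nat \<Rightarrow> nat \<Rightarrow> leaf_labeled_tree set" where
  "leaf_labeled_dary_trees d m = dary_representatives d m // leaf_iso_rel d m"

primrec leaf_index :: "vertex \<Rightarrow> nat" where
  "leaf_index (Leaf i) = i"
| "leaf_index (Node i) = 0"

definition forget_labels :: "nat \<Rightarrow> nat \<Rightarrow> vertex rtree \<Rightarrow> leaf_labeled_tree" where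
  "forget_labels d m T = leaf_iso_rel d m `` {(T, leaf_index)}"

end

(* Growing with a multiset w_1 <= ... <= w_d is done one vertex at a time: after j steps the tree
   lies in the set of trees with degrees (d_1, ..., d_m, j). The last step can be undone. If the newest
   leaf hangs from the new node, w_j = w_(j-1); otherwise w_j is, among the children of the new node
   with no new leaf below them, the one whose smallest leaf below is largest, and it goes back to the
   place of the newest leaf. This works because v precedes w whenever v is an ancestor of w or
   the smallest leaf below v is smaller than that below w. By pigeonhole (j children, j - 1 new leaves)
   such a child always exists, so growth is a bijection from pairs (tree, multiset) onto the
   larger trees, and uniformity propagates.

   A tree with labeled leaves has no nontrivial automorphism, so each leaf-labeled d-ary tree arises
   from exactly m! labelings of its m internal nodes, and (m - 1)! of them put m on a given node. *)

theory Submission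
  imports Defs
begin

section \<open>Rooted trees\<close>

text \<open>The order lives on the input tree, while the inverse sees only the output; this mismatch
  shapes the bijection proof. The bridge is the smallest leaf: different children of the new node
  have disjoint sets of leaves below them, so if two such subtrees survive the growth unchanged,
  their order in the input can be read off in the output. The finer part of the order, ancestors
  first, has two tasks: a vertex about to be moved has no earlier entry below it, so no cycle
  arises, and it settles the case in which the undone vertex goes back below the preceding entry. A
  second obstacle is that \<open>grow\<close> adds all new vertices before it touches any edge, so
  its intermediate values are not rooted trees. Uniformity passes on because all trees with given
  degrees share one vertex set: tree and multiset range over a product.\<close>

lemma rooted_treeI:
  assumes "finite (tverts T)" "troot T \<in> tverts T" "tarcs T \<subseteq> tverts T \<times> tverts T"
    and "\<And>u. (u, troot T) \<notin> tarcs T"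
    and "\<And>u u' v. (u, v) \<in> tarcs T \<Longrightarrow> (u', v) \<in> tarcs T \<Longrightarrow> u = u'"
    and "\<And>v. v \<in> tverts T \<Longrightarrow> (troot T, v) \<in> (tarcs T)\<^sup>*"
  shows "rooted_tree T"
proof -
  \<comment> \<open>Existence of a parent is free: it is the start of the last arc on the path from
    the root.\<close>
  have "\<exists>!u. (u, v) \<in> tarcs T" if v: "v \<in> tverts T - {troot T}" for v
  proof -
    have "(troot T, v) \<in> (tarcs T)\<^sup>*" using v assms(6) by auto
    then obtain u where "(u, v) \<in> tarcs T" using v by (auto elim: rtranclE)
    then show ?thesis using assms(5) by blast
  qed
  then show ?thesis using assms(1-4,6) unfolding rooted_tree_def by simp
qed

lemma tree_finite: "rooted_tree T \<Longrightarrow> finite (tverts T)"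
  and tree_root: "rooted_tree T \<Longrightarrow> troot T \<in> tverts T"
  and tree_arc_verts: "rooted_tree T \<Longrightarrow> (u, v) \<in> tarcs T \<Longrightarrow> u \<in> tverts T \<and> v \<in> tverts T"
  and tree_no_arc_root: "rooted_tree T \<Longrightarrow> (u, troot T) \<notin> tarcs T"
  and tree_reach: "rooted_tree T \<Longrightarrow> v \<in> tverts T \<Longrightarrow> (troot T, v) \<in> (tarcs T)\<^sup>*"
  unfolding rooted_tree_def by auto

lemma tree_parent_unique:
  assumes "rooted_tree T" "(u, v) \<in> tarcs T" "(u', v) \<in> tarcs T"
  shows "u = u'"
proof -
  have "v \<in> tverts T - {troot T}" using assms unfolding rooted_tree_def by blast
  then have "\<exists>!u. (u, v) \<in> tarcs T" using assms unfolding rooted_tree_def by blast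
  then show ?thesis using assms by blast
qed

lemma parent_eq: "rooted_tree T \<Longrightarrow> (u, v) \<in> tarcs T \<Longrightarrow> parent T v = u"
  unfolding parent_def using tree_parent_unique by (metis the_equality)

lemma parent_arc:
  assumes "rooted_tree T" "v \<in> tverts T" "v \<noteq> troot T"
  shows "(parent T v, v) \<in> tarcs T"
proof -
  obtain u where "(u, v) \<in> tarcs T" using assms unfolding rooted_tree_def by blast
  then show ?thesis using parent_eq assms(1) by metis
qed

lemma tree_arc_iff_parent:
  assumes "rooted_tree T" "v \<in> tverts T" "v \<noteq> troot T"
  shows "(u, v) \<in> tarcs T \<longleftrightarrow> u = parent T v"
  using parent_arc[OF assms] parent_eq[OF assms(1)] by blast

lemma tree_desc_verts: "rooted_tree T \<Longrightarrow> u \<in> tverts T \<Longrightarrow> (u, v) \<in> (tarcs T)\<^sup>* \<Longrightarrow> v \<in> tverts T"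
  by (erule rtrancl_induct) (auto dest: tree_arc_verts)

lemma tree_anc_verts: "rooted_tree T \<Longrightarrow> v \<in> tverts T \<Longrightarrow> (u, v) \<in> (tarcs T)\<^sup>* \<Longrightarrow> u \<in> tverts T"
  by (erule converse_rtrancl_induct) (auto dest: tree_arc_verts)

text \<open>Parents are unique, so a cycle through a vertex also passes through its parent. Pushed
  up along the path from the root, it would end at the root, which no arc enters.\<close>

lemma tree_acyclic:
  assumes T: "rooted_tree T"
  shows "(v, v) \<notin> (tarcs T)\<^sup>+"
proof
  assume c: "(v, v) \<in> (tarcs T)\<^sup>+"
  then obtain u where "(u, v) \<in> tarcs T" by (blast elim: tranclE)
  then have "v \<in> tverts T" using tree_arc_verts[OF T, of u v] by simp
  then have "(troot T, v) \<in> (tarcs T)\<^sup>*" by (rule tree_reach[OF T])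
  then have "(v, v) \<notin> (tarcs T)\<^sup>+"
  proof (induction rule: rtrancl_induct)
    case base
    then show ?case using tree_no_arc_root[OF T] by (meson tranclE)
  next
    case (step y z)
    show ?case
    proof
      assume "(z, z) \<in> (tarcs T)\<^sup>+"
      then obtain y' where y': "(z, y') \<in> (tarcs T)\<^sup>*" "(y', z) \<in> tarcs T"
        by (meson tranclD2)
      then have "y' = y" using step tree_parent_unique[OF T] by blast
      then have "(y, y) \<in> (tarcs T)\<^sup>+" using y' by (meson rtrancl_into_trancl2)
      then show False using step by blast
    qed
  qed
  then show False using c by blast
qed

lemma tree_antisym:
  assumes "rooted_tree T" "(u, v) \<in> (tarcs T)\<^sup>*" "(v, u) \<in> (tarcs T)\<^sup>*"
  shows "u = v"
  using tree_acyclic[OF assms(1)] assms(2,3)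
  by (metis rtranclD trancl_rtrancl_trancl)

lemma tree_arc_no_back:
  assumes "rooted_tree T" "(u, v) \<in> tarcs T"
  shows "(v, u) \<notin> (tarcs T)\<^sup>*"
  using tree_acyclic[OF assms(1)] assms(2) by (meson rtrancl_into_trancl2)

lemma tree_ancestors_chain:
  assumes T: "rooted_tree T" and "(u, z) \<in> (tarcs T)\<^sup>*" "(v, z) \<in> (tarcs T)\<^sup>*"
  shows "(u, v) \<in> (tarcs T)\<^sup>* \<or> (v, u) \<in> (tarcs T)\<^sup>*"
  using assms(2,3)
proof (induction rule: rtrancl_induct)
  case base
  then show ?case by blast
next
  case (step y z)
  then show ?case
    using tree_parent_unique[OF T] by (metis rtrancl.rtrancl_into_rtrancl rtranclE)
qed

text \<open>Of two siblings with a common descendant one would lie above the other, and the path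
  between them would have to end with the arc from the common parent. This is what separates the
  children of the new node by the leaves below them.\<close>

lemma tree_siblings_disjoint:
  assumes T: "rooted_tree T" and a: "(x, a) \<in> tarcs T" and b: "(x, b) \<in> tarcs T"
    and "(a, z) \<in> (tarcs T)\<^sup>*" "(b, z) \<in> (tarcs T)\<^sup>*"
  shows "a = b"
proof -
  have *: "c = e" if "(x, c) \<in> tarcs T" "(x, e) \<in> tarcs T" "(c, e) \<in> (tarcs T)\<^sup>*" for c e
    using that(3)
  proof (cases rule: rtranclE)
    case (step y)
    then have "y = x" using tree_parent_unique[OF T] that by blast
    then show ?thesis using tree_arc_no_back[OF T that(1)] step by blast
  qed
  show ?thesis using tree_ancestors_chain[OF T assms(4,5)] *[OF a b] *[OF b a] by blast
qed

lemma tree_leaf_below: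
  assumes T: "rooted_tree T" and v: "v \<in> tverts T"
  shows "\<exists>z \<in> leaves T. (v, z) \<in> (tarcs T)\<^sup>*"
proof -
  have "finite (tarcs T)"
    using T unfolding rooted_tree_def by (meson finite_SigmaI finite_subset)
  moreover have "acyclic (tarcs T)" unfolding acyclic_def using tree_acyclic[OF T] by blast
  ultimately have wf: "wf ((tarcs T)\<inverse>)" by (rule finite_acyclic_wf_converse)
  show ?thesis using v
  proof (induction v rule: wf_induct_rule[OF wf])
    case (1 v)
    show ?case
    proof (cases "children T v = {}")
      case True
      then show ?thesis using 1 unfolding leaves_def by blast
    next
      case False
      then obtain w where w: "(v, w) \<in> tarcs T" unfolding children_def by blast
      then obtain z where "z \<in> leaves T" "(w, z) \<in> (tarcs T)\<^sup>*"
        using 1 tree_arc_verts[OF T w] by blast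
      then show ?thesis using w by (meson converse_rtrancl_into_rtrancl)
    qed
  qed
qed

text \<open>The relations are compared only where \<open>R\<close> leads from \<open>y\<close>; a
  walk along \<open>S\<close> from \<open>y\<close> never leaves that region, so the one-sided
  hypothesis gives an equivalence. It is the tool for showing that a subtree is not affected by
  changes elsewhere.\<close>

lemma descendants_cong:
  assumes "\<And>u. (y, u) \<in> R\<^sup>* \<Longrightarrow> R `` {u} = S `` {u}"
  shows "(y, z) \<in> R\<^sup>* \<longleftrightarrow> (y, z) \<in> S\<^sup>*"
proof
  assume "(y, z) \<in> R\<^sup>*"
  then show "(y, z) \<in> S\<^sup>*"
  proof (induction rule: rtrancl_induct)
    case (step u v)
    then show ?case using assms[of u] by (auto intro: rtrancl_into_rtrancl)
  qed auto
next
  assume "(y, z) \<in> S\<^sup>*"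
  then show "(y, z) \<in> R\<^sup>*"
  proof (induction rule: rtrancl_induct)
    case (step u v)
    then have "(u, v) \<in> R" using assms[of u] by auto
    then show ?case using step by (auto intro: rtrancl_into_rtrancl)
  qed auto
qed

lemma desc_cong:
  assumes "\<And>u. (y, u) \<in> (tarcs T)\<^sup>* \<Longrightarrow> children T u = children T' u"
  shows "(y, z) \<in> (tarcs T)\<^sup>* \<longleftrightarrow> (y, z) \<in> (tarcs T')\<^sup>*"
  using descendants_cong[of y "tarcs T" "tarcs T'"] assms
  unfolding children_def by (simp add: Image_singleton)

lemma rtree_eqI:
  "tverts T = tverts T' \<Longrightarrow> troot T = troot T' \<Longrightarrow> tarcs T = tarcs T' \<Longrightarrow> T = (T' :: 'v rtree)"
  by (rule rtree.equality) auto

section \<open>Elementary modifications of trees\<close>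

text \<open>Every growth step and its inverse is composed of these five operations;
  \<open>reparent\<close> with the old parent undoes \<open>reparent\<close>.\<close>

definition add_leaf :: "'v \<Rightarrow> 'v \<Rightarrow> 'v rtree \<Rightarrow> 'v rtree" where
  "add_leaf p l T = T\<lparr>tverts := insert l (tverts T), tarcs := insert (p, l) (tarcs T)\<rparr>"

definition del_leaf :: "'v \<Rightarrow> 'v rtree \<Rightarrow> 'v rtree" where
  "del_leaf l T = T\<lparr>tverts := tverts T - {l}, tarcs := {(u, v) \<in> tarcs T. v \<noteq> l}\<rparr>"

definition reparent :: "'v \<Rightarrow> 'v \<Rightarrow> 'v rtree \<Rightarrow> 'v rtree" where
  "reparent w x T = T\<lparr>tarcs := insert (x, w) {(u, v) \<in> tarcs T. v \<noteq> w}\<rparr>"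

definition add_root :: "'v \<Rightarrow> 'v rtree \<Rightarrow> 'v rtree" where
  "add_root x T =
     T\<lparr>tverts := insert x (tverts T), troot := x, tarcs := insert (x, troot T) (tarcs T)\<rparr>"

text \<open>Meant for a root whose only child is \<open>w\<close>: dropping the arcs into
  \<open>w\<close> then drops exactly the arc that leaves the old root.\<close>

definition del_root :: "'v \<Rightarrow> 'v rtree \<Rightarrow> 'v rtree" where
  "del_root w T =
     T\<lparr>tverts := tverts T - {troot T}, troot := w, tarcs := {(u, v) \<in> tarcs T. v \<noteq> w}\<rparr>"

lemma add_leaf_simps [simp]:
  "tverts (add_leaf p l T) = insert l (tverts T)"
  "troot (add_leaf p l T) = troot T"
  "tarcs (add_leaf p l T) = insert (p, l) (tarcs T)"
  by (auto simp: add_leaf_def)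

lemma del_leaf_simps [simp]:
  "tverts (del_leaf l T) = tverts T - {l}"
  "troot (del_leaf l T) = troot T"
  "tarcs (del_leaf l T) = {(u, v) \<in> tarcs T. v \<noteq> l}"
  by (auto simp: del_leaf_def)

lemma reparent_simps [simp]:
  "tverts (reparent w x T) = tverts T"
  "troot (reparent w x T) = troot T"
  "tarcs (reparent w x T) = insert (x, w) {(u, v) \<in> tarcs T. v \<noteq> w}"
  by (auto simp: reparent_def)

lemma add_root_simps [simp]:
  "tverts (add_root x T) = insert x (tverts T)"
  "troot (add_root x T) = x"
  "tarcs (add_root x T) = insert (x, troot T) (tarcs T)"
  by (auto simp: add_root_def)

lemma del_root_simps [simp]:
  "tverts (del_root w T) = tverts T - {troot T}"
  "troot (del_root w T) = w"
  "tarcs (del_root w T) = {(u, v) \<in> tarcs T. v \<noteq> w}"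
  by (auto simp: del_root_def)

lemma rooted_tree_add_leaf:
  assumes T: "rooted_tree T" and p: "p \<in> tverts T" and l: "l \<notin> tverts T"
  shows "rooted_tree (add_leaf p l T)"
proof (rule rooted_treeI)
  show "finite (tverts (add_leaf p l T))" using tree_finite[OF T] by simp
  show "troot (add_leaf p l T) \<in> tverts (add_leaf p l T)" using tree_root[OF T] by simp
  show "tarcs (add_leaf p l T) \<subseteq> tverts (add_leaf p l T) \<times> tverts (add_leaf p l T)"
    using tree_arc_verts[OF T] p by auto
  show "(u, troot (add_leaf p l T)) \<notin> tarcs (add_leaf p l T)" for u
    using tree_no_arc_root[OF T] tree_root[OF T] l by auto
  show "u = u'" if "(u, v) \<in> tarcs (add_leaf p l T)" "(u', v) \<in> tarcs (add_leaf p l T)" for u u' v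
    using that l tree_arc_verts[OF T] tree_parent_unique[OF T] by auto
  have mono: "(tarcs T)\<^sup>* \<subseteq> (tarcs (add_leaf p l T))\<^sup>*" by (intro rtrancl_mono) auto
  show "(troot (add_leaf p l T), v) \<in> (tarcs (add_leaf p l T))\<^sup>*"
    if "v \<in> tverts (add_leaf p l T)" for v
  proof (cases "v = l")
    case True
    have "(troot T, p) \<in> (tarcs (add_leaf p l T))\<^sup>*" using mono tree_reach[OF T p] by blast
    then show ?thesis using True by (auto intro: rtrancl_into_rtrancl)
  next
    case False
    then have "(troot T, v) \<in> (tarcs T)\<^sup>*" using that tree_reach[OF T] by simp
    then show ?thesis using mono by auto
  qed
qed

lemma rooted_tree_del_leaf:
  assumes T: "rooted_tree T" and l: "l \<noteq> troot T" and c: "children T l = {}"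
  shows "rooted_tree (del_leaf l T)"
proof (rule rooted_treeI)
  have nl: "(l, v) \<notin> tarcs T" for v using c unfolding children_def by blast
  show "finite (tverts (del_leaf l T))" using tree_finite[OF T] by simp
  show "troot (del_leaf l T) \<in> tverts (del_leaf l T)" using tree_root[OF T] l by simp
  show "tarcs (del_leaf l T) \<subseteq> tverts (del_leaf l T) \<times> tverts (del_leaf l T)"
    using tree_arc_verts[OF T] nl by auto
  show "(u, troot (del_leaf l T)) \<notin> tarcs (del_leaf l T)" for u
    using tree_no_arc_root[OF T] by auto
  show "u = u'" if "(u, v) \<in> tarcs (del_leaf l T)" "(u', v) \<in> tarcs (del_leaf l T)" for u u' v
    using that tree_parent_unique[OF T] by auto
  show "(troot (del_leaf l T), v) \<in> (tarcs (del_leaf l T))\<^sup>*" if "v \<in> tverts (del_leaf l T)" for v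
  proof -
    have "(troot T, v) \<in> (tarcs T)\<^sup>*" "v \<noteq> l" using that tree_reach[OF T] by auto
    then have "(troot T, v) \<in> (tarcs (del_leaf l T))\<^sup>*"
    proof (induction rule: rtrancl_induct)
      case (step y z)
      then have "y \<noteq> l" using nl by blast
      moreover have "(y, z) \<in> tarcs (del_leaf l T)" using step by simp
      ultimately show ?case using step by (meson rtrancl.rtrancl_into_rtrancl)
    qed simp
    then show ?thesis by simp
  qed
qed

text \<open>Of a path from the root, either all of it survives or the part after the arc into
  \<open>w\<close> does. Since \<open>w\<close> gains no descendants and \<open>x\<close> is not
  below it, \<open>x\<close> is still reached from the root, and through \<open>x\<close> so is
  \<open>w\<close>.\<close>

lemma rooted_tree_reparent:
  assumes T: "rooted_tree T" and w: "w \<in> tverts T" "w \<noteq> troot T" and x: "x \<in> tverts T"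
    and n: "(w, x) \<notin> (tarcs T)\<^sup>*"
  shows "rooted_tree (reparent w x T)"
proof (rule rooted_treeI)
  let ?R = "tarcs (reparent w x T)"
  show "finite (tverts (reparent w x T))" using tree_finite[OF T] by simp
  show "troot (reparent w x T) \<in> tverts (reparent w x T)" using tree_root[OF T] by simp
  show "?R \<subseteq> tverts (reparent w x T) \<times> tverts (reparent w x T)"
    using tree_arc_verts[OF T] w x by auto
  show "(u, troot (reparent w x T)) \<notin> ?R" for u
    using tree_no_arc_root[OF T] w by auto
  show "u = u'" if "(u, v) \<in> ?R" "(u', v) \<in> ?R" for u u' v
    using that tree_parent_unique[OF T] by auto
  have or: "(troot T, v) \<in> ?R\<^sup>* \<or> (w, v) \<in> ?R\<^sup>*" if "(troot T, v) \<in> (tarcs T)\<^sup>*" for v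
    using that
  proof (induction rule: rtrancl_induct)
    case (step y z)
    show ?case
    proof (cases "z = w")
      case False
      then have "(y, z) \<in> ?R" using step by simp
      then show ?thesis using step.IH by (meson rtrancl.rtrancl_into_rtrancl)
    qed simp
  qed simp
  have "(w, v) \<in> (tarcs T)\<^sup>*" if "(w, v) \<in> ?R\<^sup>*" for v
    using that
  proof (induction rule: rtrancl_induct)
    case (step y z)
    then show ?case by (cases "z = w") (auto intro: rtrancl_into_rtrancl)
  qed simp
  then have "(troot T, x) \<in> ?R\<^sup>*" using or n tree_reach[OF T x] by blast
  then have "(troot T, w) \<in> ?R\<^sup>*" by (rule rtrancl_into_rtrancl) simp
  then show "(troot (reparent w x T), v) \<in> ?R\<^sup>*" if "v \<in> tverts (reparent w x T)" for v
    using or[of v] tree_reach[OF T] that by (auto intro: rtrancl_trans)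
qed

lemma rooted_tree_add_root:
  assumes T: "rooted_tree T" and x: "x \<notin> tverts T"
  shows "rooted_tree (add_root x T)"
proof (rule rooted_treeI)
  show "finite (tverts (add_root x T))" using tree_finite[OF T] by simp
  show "troot (add_root x T) \<in> tverts (add_root x T)" by simp
  show "tarcs (add_root x T) \<subseteq> tverts (add_root x T) \<times> tverts (add_root x T)"
    using tree_arc_verts[OF T] tree_root[OF T] by auto
  show "(u, troot (add_root x T)) \<notin> tarcs (add_root x T)" for u
    using tree_root[OF T] tree_arc_verts[OF T] x by auto
  show "u = u'" if "(u, v) \<in> tarcs (add_root x T)" "(u', v) \<in> tarcs (add_root x T)" for u u' v
    using that tree_no_arc_root[OF T] tree_parent_unique[OF T] by auto
  have mono: "(tarcs T)\<^sup>* \<subseteq> (tarcs (add_root x T))\<^sup>*" by (intro rtrancl_mono) auto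
  show "(troot (add_root x T), v) \<in> (tarcs (add_root x T))\<^sup>*"
    if "v \<in> tverts (add_root x T)" for v
  proof (cases "v = x")
    case False
    then have "(troot T, v) \<in> (tarcs (add_root x T))\<^sup>*" using that tree_reach[OF T] mono by auto
    then show ?thesis by (auto intro: converse_rtrancl_into_rtrancl)
  qed simp
qed

lemma rooted_tree_del_root:
  assumes T: "rooted_tree T" and c: "children T (troot T) = {w}"
  shows "rooted_tree (del_root w T)"
proof (rule rooted_treeI)
  let ?R = "tarcs (del_root w T)"
  have rw: "(troot T, v) \<in> tarcs T \<longleftrightarrow> v = w" for v using c unfolding children_def by auto
  have w: "w \<in> tverts T" "w \<noteq> troot T"
    using rw tree_arc_verts[OF T] tree_no_arc_root[OF T] by blast+
  have into_w: "u = troot T" if "(u, w) \<in> tarcs T" for u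
    using tree_parent_unique[OF T that] rw by blast
  show "finite (tverts (del_root w T))" using tree_finite[OF T] by simp
  show "troot (del_root w T) \<in> tverts (del_root w T)" using w by simp
  show "?R \<subseteq> tverts (del_root w T) \<times> tverts (del_root w T)"
    using tree_arc_verts[OF T] tree_no_arc_root[OF T] rw by auto
  show "(u, troot (del_root w T)) \<notin> ?R" for u by simp
  show "u = u'" if "(u, v) \<in> ?R" "(u', v) \<in> ?R" for u u' v
    using that tree_parent_unique[OF T] by auto
  show "(troot (del_root w T), v) \<in> ?R\<^sup>*" if v: "v \<in> tverts (del_root w T)" for v
  proof -
    have "(troot T, v) \<in> (tarcs T)\<^sup>*" "v \<noteq> troot T" using v tree_reach[OF T] by auto
    then have "(w, v) \<in> ?R\<^sup>*"
    proof (induction rule: rtrancl_induct)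
      case (step y z)
      show ?case
      proof (cases "z = w")
        case False
        then have "y \<noteq> troot T" using step rw by blast
        moreover have "(y, z) \<in> ?R" using step False by simp
        ultimately show ?thesis using step by (meson rtrancl.rtrancl_into_rtrancl)
      qed simp
    qed simp
    then show ?thesis by simp
  qed
qed

lemma children_add_leaf: "children (add_leaf p l T) u = (if u = p then insert l (children T u) else children T u)"
  unfolding children_def by auto

lemma children_reparent:
  "children (reparent w x T) u = (if u = x then insert w (children T u) else children T u - {w})"
  unfolding children_def by auto

lemma children_del_leaf: "children (del_leaf l T) u = children T u - {l}"
  unfolding children_def by auto

lemma children_del_root: "children (del_root w T) u = children T u - {w}"
  unfolding children_def by auto

lemma children_add_root:
  "children (add_root x T) u = (if u = x then insert (troot T) (children T u) else children T u)"
  unfolding children_def by auto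

section \<open>The order on the vertices\<close>

definition ancestor_closed :: "'v rtree \<Rightarrow> 'v set \<Rightarrow> bool" where
  "ancestor_closed T S \<longleftrightarrow> (\<forall>u v. (u, v) \<in> tarcs T \<longrightarrow> v \<in> S \<longrightarrow> u \<in> S)"

text \<open>The directed counterpart of the condition in \<open>branch_path\<close>. Directed paths
  can be built and compared arc by arc with the help of unique parents.\<close>

definition down_path :: "'v rtree \<Rightarrow> 'v set \<Rightarrow> 'v \<Rightarrow> 'v list \<Rightarrow> bool" where
  "down_path T S z xs \<longleftrightarrow> xs \<noteq> [] \<and> successively (\<lambda>u v. (u, v) \<in> tarcs T) xs \<and>
     hd xs \<in> S \<and> set (tl xs) \<inter> S = {} \<and> last xs = z"

text \<open>After one downward arc a path without repetition must keep descending, because the only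
  way up leads back to the vertex just left. So only the first arc has to be prevented from going
  up.\<close>

lemma successively_adjacent_descends:
  assumes T: "rooted_tree T"
  shows "distinct (s # xs) \<Longrightarrow> successively (adjacent T) (s # xs) \<Longrightarrow>
    \<forall>u. (u, s) \<in> tarcs T \<longrightarrow> u \<notin> set xs \<Longrightarrow> successively (\<lambda>u v. (u, v) \<in> tarcs T) (s # xs)"
proof (induction xs arbitrary: s)
  case (Cons y ys)
  then have sy: "(s, y) \<in> tarcs T" by (auto simp: adjacent_def)
  moreover have "\<forall>u. (u, y) \<in> tarcs T \<longrightarrow> u \<notin> set ys"
    using tree_parent_unique[OF T sy] Cons.prems(1) by auto
  ultimately show ?case using Cons by simp
qed simp

lemma tree_path_down:
  assumes T: "rooted_tree T" and S: "ancestor_closed T S"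
    and p: "tree_path T xs" "hd xs \<in> S" "set (tl xs) \<inter> S = {}"
  shows "down_path T S (last xs) xs"
proof -
  obtain s ys where xs: "xs = s # ys" using p(1) unfolding tree_path_def by (cases xs) auto
  have "successively (\<lambda>u v. (u, v) \<in> tarcs T) (s # ys)"
    \<comment> \<open>The parent of the starting vertex lies in \<open>S\<close> by ancestor
      closure, while the rest of the path avoids \<open>S\<close>.\<close>
    using p S unfolding tree_path_def xs ancestor_closed_def
    by (intro successively_adjacent_descends[OF T]) auto
  then show ?thesis using p unfolding down_path_def xs by simp
qed

lemma down_path_sorted:
  assumes "down_path T S z xs"
  shows "sorted_wrt (\<lambda>u v. (u, v) \<in> (tarcs T)\<^sup>+) xs"
proof -
  have "successively (\<lambda>u v. (u, v) \<in> (tarcs T)\<^sup>+) xs"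
    using assms unfolding down_path_def by (auto elim: successively_mono)
  moreover have "transp (\<lambda>u v. (u, v) \<in> (tarcs T)\<^sup>+)" by (auto simp: transp_def)
  ultimately show ?thesis by (simp add: successively_conv_sorted_wrt)
qed

text \<open>Read backwards from \<open>z\<close> the path is forced: each predecessor is the parent,
  and it stops at the first vertex of \<open>S\<close> that is met.\<close>

lemma down_path_unique:
  assumes T: "rooted_tree T"
  shows "down_path T S z xs \<Longrightarrow> down_path T S z ys \<Longrightarrow> xs = ys"
proof (induction xs arbitrary: z ys rule: rev_induct)
  case (snoc a xs)
  have a: "a = z" using snoc.prems unfolding down_path_def by simp
  obtain ys' where ys: "ys = ys' @ [z]"
    using snoc.prems(2) unfolding down_path_def by (metis append_butlast_last_id)
  show ?case
  proof (cases "z \<in> S")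
    case True
    then have "xs = []" using snoc.prems(1) unfolding down_path_def a by (cases xs) auto
    moreover have "ys' = []" using True snoc.prems(2) unfolding down_path_def ys by (cases ys') auto
    ultimately show ?thesis using a ys by simp
  next
    case False
    then have ne: "xs \<noteq> []" "ys' \<noteq> []"
      using snoc.prems unfolding down_path_def ys a by auto
    then have "(last xs, z) \<in> tarcs T" "(last ys', z) \<in> tarcs T"
      using snoc.prems unfolding down_path_def ys a by (auto simp: successively_append_iff)
    then have "last xs = last ys'" using tree_parent_unique[OF T] by blast
    moreover have "down_path T S (last xs) xs" "down_path T S (last ys') ys'"
      using snoc.prems ne unfolding down_path_def ys a by (auto simp: successively_append_iff)
    ultimately have "xs = ys'" using snoc.IH by metis
    then show ?thesis using a ys by simp
  qed
qed (simp add: down_path_def)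

lemma down_path_exists:
  assumes T: "rooted_tree T" and S: "troot T \<in> S" and z: "z \<in> tverts T"
  shows "\<exists>xs. down_path T S z xs"
  using tree_reach[OF T z]
proof (induction rule: rtrancl_induct)
  case base
  have "down_path T S (troot T) [troot T]" using S unfolding down_path_def by simp
  then show ?case by blast
next
  case (step y z)
  then obtain xs where xs: "down_path T S y xs" by blast
  show ?case
  proof (cases "z \<in> S")
    case True
    then have "down_path T S z [z]" unfolding down_path_def by simp
    then show ?thesis by blast
  next
    case False
    then have "down_path T S z (xs @ [z])"
      using xs step(2) unfolding down_path_def by (auto simp: successively_append_iff)
    then show ?thesis by blast
  qed
qed

lemma down_path_above:
  assumes "down_path T S z xs" "v \<in> set xs"
  shows "(v, z) \<in> (tarcs T)\<^sup>*"
proof -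
  obtain ys where ys: "xs = ys @ [z]"
    using assms(1) unfolding down_path_def by (metis append_butlast_last_id)
  have "sorted_wrt (\<lambda>u v. (u, v) \<in> (tarcs T)\<^sup>+) xs" using down_path_sorted[OF assms(1)] .
  then show ?thesis using assms(2) unfolding ys by (auto simp: sorted_wrt_append intro: trancl_into_rtrancl)
qed

lemma down_path_tree_path:
  assumes T: "rooted_tree T" and z: "z \<in> tverts T" and p: "down_path T S z xs"
  shows "tree_path T xs"
proof -
  have "sorted_wrt (\<lambda>u v. u \<noteq> v) xs"
    using down_path_sorted[OF p] tree_acyclic[OF T] by (auto elim!: sorted_wrt_mono_rel[rotated])
  moreover have "successively (adjacent T) xs"
    using p unfolding down_path_def by (auto elim: successively_mono simp: adjacent_def)
  moreover have "set xs \<subseteq> tverts T"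
    using down_path_above[OF p] tree_anc_verts[OF T z] by blast
  ultimately show ?thesis using p unfolding tree_path_def down_path_def
    by (simp add: distinct_conv_nth sorted_wrt_iff_nth_less) (metis linorder_neqE_nat)
qed

section \<open>The sets S_i and the reading order\<close>

lemma branch_path_down:
  assumes T: "rooted_tree T" and S: "ancestor_closed T S" "troot T \<in> S" and l: "Leaf i \<in> tverts T"
  shows "down_path T S (Leaf i) (branch_path T S i)"
proof -
  obtain xs where xs: "down_path T S (Leaf i) xs" using down_path_exists[OF T S(2) l] by blast
  have "branch_path T S i = xs"
    unfolding branch_path_def
  proof (rule the_equality)
    show "tree_path T xs \<and> hd xs \<in> S \<and> set (tl xs) \<inter> S = {} \<and> last xs = Leaf i"
      using down_path_tree_path[OF T l xs] xs unfolding down_path_def by simp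
    show "ys = xs" if "tree_path T ys \<and> hd ys \<in> S \<and> set (tl ys) \<inter> S = {} \<and> last ys = Leaf i" for ys
      using that down_path_unique[OF T xs] tree_path_down[OF T S(1), of ys] by simp
  qed
  then show ?thesis using xs by simp
qed

lemma down_path_covers:
  assumes T: "rooted_tree T" and S: "ancestor_closed T S" and p: "down_path T S z xs"
    and v: "(v, z) \<in> (tarcs T)\<^sup>*"
  shows "v \<in> S \<union> set xs"
  using v
proof (induction rule: converse_rtrancl_induct)
  case base
  then show ?case using p unfolding down_path_def by auto
next
  case (step u v)
  show ?case
  proof (cases "v \<in> S")
    case True
    then show ?thesis using S step(1) unfolding ancestor_closed_def by blast
  next
    case False
    then obtain ys zs where xs: "xs = ys @ v # zs" using step.IH by (auto dest: split_list)
    have "ys \<noteq> []" using p False xs unfolding down_path_def by auto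
    then have "(last ys, v) \<in> tarcs T"
      using p unfolding down_path_def xs by (auto simp: successively_append_iff)
    then have "u = last ys" using tree_parent_unique[OF T] step(1) by blast
    then show ?thesis using \<open>ys \<noteq> []\<close> xs by simp
  qed
qed

lemma branch_path_span:
  assumes T: "rooted_tree T" and S: "ancestor_closed T S" "troot T \<in> S" and l: "Leaf i \<in> tverts T"
  shows "S \<union> set (branch_path T S i) = S \<union> {v. (v, Leaf i) \<in> (tarcs T)\<^sup>*}"
  using down_path_covers[OF T S(1) branch_path_down[OF assms]]
    down_path_above[OF branch_path_down[OF assms]] by blast

lemma labeled_treesD:
  assumes "T \<in> labeled_trees ds"
  shows "rooted_tree T" and "tverts T = Node ` {1..length ds} \<union> Leaf ` {1..num_leaves ds}"
    and "\<And>i. i \<in> {1..length ds} \<Longrightarrow> card (children T (Node i)) = ds ! (i - 1)"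
    and "\<And>i. children T (Leaf i) = {}"
proof -
  show T: "rooted_tree T" and V: "tverts T = Node ` {1..length ds} \<union> Leaf ` {1..num_leaves ds}"
    and "\<And>i. i \<in> {1..length ds} \<Longrightarrow> card (children T (Node i)) = ds ! (i - 1)"
    using assms unfolding labeled_trees_def by auto
  show "children T (Leaf i) = {}" for i
  proof (cases "i \<in> {1..num_leaves ds}")
    case True
    then show ?thesis using assms unfolding labeled_trees_def by auto
  next
    case False
    then have "Leaf i \<notin> tverts T" using V by auto
    then show ?thesis unfolding children_def using tree_arc_verts[OF T] by auto
  qed
qed

lemma labeled_trees_leaf_mem:
  "T \<in> labeled_trees ds \<Longrightarrow> Leaf i \<in> tverts T \<longleftrightarrow> i \<in> {1..num_leaves ds}"
  using labeled_treesD(2) by auto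

text \<open>S_i consists of the ancestors of the first i leaves; the root is listed apart to cover i
  = 0. The explicit set is visibly ancestor closed, which is what the next branch path
  requires.\<close>

lemma spanned_properties:
  assumes T: "T \<in> labeled_trees ds" and i: "i \<le> num_leaves ds"
  shows "spanned T i = {troot T} \<union> {v. \<exists>j \<in> {1..i}. (v, Leaf j) \<in> (tarcs T)\<^sup>*}"
    and "ancestor_closed T (spanned T i)"
proof -
  note R = labeled_treesD(1)[OF T]
  have closed: "ancestor_closed T ({troot T} \<union> {v. \<exists>j \<in> {1..i}. (v, Leaf j) \<in> (tarcs T)\<^sup>*})" for i
    unfolding ancestor_closed_def
    using tree_no_arc_root[OF R] by (auto intro: converse_rtrancl_into_rtrancl)
  show eq: "spanned T i = {troot T} \<union> {v. \<exists>j \<in> {1..i}. (v, Leaf j) \<in> (tarcs T)\<^sup>*}"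
    using i
  proof (induction i)
    case (Suc i)
    have "Leaf (Suc i) \<in> tverts T" using Suc.prems labeled_trees_leaf_mem[OF T] by auto
    then have "spanned T (Suc i) = spanned T i \<union> {v. (v, Leaf (Suc i)) \<in> (tarcs T)\<^sup>*}"
      using branch_path_span[OF R, of "spanned T i" "Suc i"] Suc closed[of i] by simp
    also have "\<dots> = {troot T} \<union> {v. \<exists>j \<in> {1..Suc i}. (v, Leaf j) \<in> (tarcs T)\<^sup>*}"
      using Suc by (auto simp: atLeastAtMostSuc_conv)
    finally show ?case .
  qed simp
  show "ancestor_closed T (spanned T i)" using closed[of i] eq by simp
qed

lemma spanned_branch_path:
  assumes T: "T \<in> labeled_trees ds" and i: "i < num_leaves ds"
  shows "down_path T (spanned T i) (Leaf (Suc i)) (branch_path T (spanned T i) (Suc i))"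
  using branch_path_down[OF labeled_treesD(1)[OF T]] spanned_properties[OF T, of i] i
    labeled_trees_leaf_mem[OF T] by simp

lemma reading_Suc: "reading T (Suc n) = reading T n @ branch_path T (spanned T n) (Suc n)"
  unfolding reading_def by simp

lemma set_reading:
  assumes T: "T \<in> labeled_trees ds"
  shows "n < num_leaves ds \<Longrightarrow> set (reading T (Suc n)) = spanned T (Suc n)"
proof (induction n)
  case 0
  have "reading T 0 = []" by (simp add: reading_def)
  \<comment> \<open>The root is in S_0 without having been read; it enters the reading because P_1
    starts there.\<close>
  moreover have "troot T \<in> set (branch_path T {troot T} (Suc 0))"
    using spanned_branch_path[OF T 0] unfolding down_path_def
    by (metis empty_iff insert_iff list.set_sel(1) spanned.simps(1))
  ultimately show ?case by (auto simp: reading_Suc)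
next
  case (Suc n)
  then show ?case by (subst reading_Suc) simp
qed

lemma reading_prefix: "n \<le> k \<Longrightarrow> \<exists>ys. reading T k = reading T n @ ys"
  by (induction k rule: dec_induct) (auto simp: reading_Suc)

lemma first_pos_nth:
  assumes "v \<in> set xs"
  shows "first_pos xs v < length xs" "xs ! first_pos xs v = v"
proof -
  have "\<exists>k. k < length xs \<and> xs ! k = v" using assms by (auto simp: in_set_conv_nth)
  from LeastI_ex[OF this] show "first_pos xs v < length xs" "xs ! first_pos xs v = v"
    unfolding first_pos_def by auto
qed

lemma first_pos_less:
  assumes "v \<in> set xs" "w \<notin> set xs" "w \<in> set ys"
  shows "first_pos (xs @ ys) v < first_pos (xs @ ys) w"
proof -
  obtain k where k: "k < length xs" "xs ! k = v" using assms(1) by (auto simp: in_set_conv_nth)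
  have "first_pos (xs @ ys) v \<le> k"
    unfolding first_pos_def by (rule Least_le) (use k in \<open>simp add: nth_append\<close>)
  moreover have "\<not> first_pos (xs @ ys) w < length xs"
    using first_pos_nth(2)[of w "xs @ ys"] assms nth_mem by (fastforce simp: nth_append)
  ultimately show ?thesis using k by simp
qed

text \<open>For a vertex of a labeled tree with positive degrees this is the index of the path in
  which the vertex is first read, hence the coarse part of the order. It depends on the descendants
  of the vertex alone, so it survives changes elsewhere in the tree.\<close>

definition min_leaf :: "vertex rtree \<Rightarrow> vertex \<Rightarrow> nat" where
  "min_leaf T v = (LEAST i. (v, Leaf i) \<in> (tarcs T)\<^sup>*)"

lemma labeled_trees_leaves:
  assumes T: "T \<in> labeled_trees ds" and pos: "\<forall>d \<in> set ds. 1 \<le> d"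
  shows "leaves T = Leaf ` {1..num_leaves ds}" and "nonleaves T = Node ` {1..length ds}"
proof -
  have "children T (Node i) \<noteq> {}" if "i \<in> {1..length ds}" for i
  proof -
    have "ds ! (i - 1) \<in> set ds" using that by (intro nth_mem) auto
    then have "card (children T (Node i)) \<ge> 1" using labeled_treesD(3)[OF T that] pos by auto
    then show ?thesis by auto
  qed
  then show "leaves T = Leaf ` {1..num_leaves ds}" "nonleaves T = Node ` {1..length ds}"
    unfolding leaves_def nonleaves_def labeled_treesD(2)[OF T] using labeled_treesD(4)[OF T] by auto
qed

lemma min_leaf_below:
  assumes T: "T \<in> labeled_trees ds" and pos: "\<forall>d \<in> set ds. 1 \<le> d" and v: "v \<in> tverts T"
  shows "(v, Leaf (min_leaf T v)) \<in> (tarcs T)\<^sup>*" "min_leaf T v \<in> {1..num_leaves ds}"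
proof -
  obtain z where "z \<in> leaves T" "(v, z) \<in> (tarcs T)\<^sup>*"
    using tree_leaf_below[OF labeled_treesD(1)[OF T] v] by blast
  then have "\<exists>i. (v, Leaf i) \<in> (tarcs T)\<^sup>*" using labeled_trees_leaves(1)[OF T pos] by auto
  then show *: "(v, Leaf (min_leaf T v)) \<in> (tarcs T)\<^sup>*" unfolding min_leaf_def by (rule LeastI_ex)
  show "min_leaf T v \<in> {1..num_leaves ds}"
    using tree_desc_verts[OF labeled_treesD(1)[OF T] v *] labeled_trees_leaf_mem[OF T] by blast
qed

lemma min_leaf_le: "(v, Leaf i) \<in> (tarcs T)\<^sup>* \<Longrightarrow> min_leaf T v \<le> i"
  unfolding min_leaf_def by (rule Least_le)

lemma reading_iff_min_leaf:
  assumes T: "T \<in> labeled_trees ds" and pos: "\<forall>d \<in> set ds. 1 \<le> d" and v: "v \<in> tverts T"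
    and n: "n \<le> num_leaves ds"
  shows "v \<in> set (reading T n) \<longleftrightarrow> min_leaf T v \<le> n"
proof (cases n)
  case 0
  then show ?thesis using min_leaf_below(2)[OF T pos v] by (auto simp: reading_def)
next
  case (Suc k)
  have root: "(troot T, Leaf 1) \<in> (tarcs T)\<^sup>*"
    using tree_reach[OF labeled_treesD(1)[OF T]] labeled_trees_leaf_mem[OF T] n Suc by simp
  have "v \<in> set (reading T n) \<longleftrightarrow> (\<exists>j \<in> {1..n}. (v, Leaf j) \<in> (tarcs T)\<^sup>*)"
    using set_reading[OF T, of k] spanned_properties(1)[OF T, of n] n Suc root by auto
  also have "\<dots> \<longleftrightarrow> min_leaf T v \<le> n"
    using min_leaf_below[OF T pos v] min_leaf_le[of v _ T] by fastforce
  finally show ?thesis .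
qed

lemma vertex_le_if_min_leaf_less:
  assumes T: "T \<in> labeled_trees ds" and pos: "\<forall>d \<in> set ds. 1 \<le> d"
    and v: "v \<in> tverts T" and w: "w \<in> tverts T" and l: "min_leaf T v < min_leaf T w"
  shows "vertex_le ds T v w"
proof -
  let ?n = "min_leaf T v"
  have n: "?n \<le> num_leaves ds" using min_leaf_below(2)[OF T pos v] by simp
  obtain ys where ys: "reading T (num_leaves ds) = reading T ?n @ ys" using reading_prefix[OF n] by blast
  have "v \<in> set (reading T ?n)" "w \<notin> set (reading T ?n)"
    using reading_iff_min_leaf[OF T pos _ n] v w l by auto
  moreover have "w \<in> set (reading T (num_leaves ds))"
    using reading_iff_min_leaf[OF T pos w order_refl] min_leaf_below(2)[OF T pos w] by simp
  ultimately show ?thesis unfolding vertex_le_def ys by (intro less_imp_le first_pos_less) auto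
qed

lemma vertex_le_antisym:
  assumes T: "T \<in> labeled_trees ds" and pos: "\<forall>d \<in> set ds. 1 \<le> d"
    and v: "v \<in> tverts T" and w: "w \<in> tverts T" and "vertex_le ds T v w" "vertex_le ds T w v"
  shows "v = w"
proof -
  have "u \<in> set (reading T (num_leaves ds))" if "u \<in> tverts T" for u
    using reading_iff_min_leaf[OF T pos that order_refl] min_leaf_below(2)[OF T pos that] by simp
  then show ?thesis using assms(5,6) v w first_pos_nth(2) unfolding vertex_le_def
    by (metis order_antisym)
qed

lemma vertex_le_ancestor:
  assumes T: "T \<in> labeled_trees ds" and pos: "\<forall>d \<in> set ds. 1 \<le> d"
    and v: "v \<in> tverts T" and vw: "(v, w) \<in> (tarcs T)\<^sup>*"
  shows "vertex_le ds T v w"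
proof -
  note R = labeled_treesD(1)[OF T]
  have w: "w \<in> tverts T" using tree_desc_verts[OF R v vw] .
  have "(v, Leaf (min_leaf T w)) \<in> (tarcs T)\<^sup>*" using min_leaf_below(1)[OF T pos w] vw by simp
  then have "min_leaf T v \<le> min_leaf T w" by (rule min_leaf_le)
  then consider "v = w" | "min_leaf T v < min_leaf T w" | "min_leaf T v = min_leaf T w" "v \<noteq> w"
    by linarith
  then show ?thesis
  proof cases
    case 1
    then show ?thesis by (simp add: vertex_le_def)
  next
    case 2
    then show ?thesis using vertex_le_if_min_leaf_less[OF T pos v w] by blast
  next
    case 3
    \<comment> \<open>With equal smallest leaves both vertices first appear on the same path. That
      path descends, so the ancestor is met first.\<close>
    obtain n where n: "min_leaf T v = Suc n" "n < num_leaves ds"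
      using min_leaf_below(2)[OF T pos v] by (cases "min_leaf T v") auto
    let ?P = "branch_path T (spanned T n) (Suc n)"
    have out: "v \<notin> set (reading T n)" "w \<notin> set (reading T n)"
      using reading_iff_min_leaf[OF T pos, of _ n] v w n 3 by auto
    have "v \<in> set (reading T (Suc n))" "w \<in> set (reading T (Suc n))"
      using reading_iff_min_leaf[OF T pos, of _ "Suc n"] v w n 3 by auto
    then have inP: "v \<in> set ?P" "w \<in> set ?P" using out by (auto simp: reading_Suc)
    obtain p q where P: "?P = p @ v # q" using split_list[OF inP(1)] by blast
    have "sorted_wrt (\<lambda>u v. (u, v) \<in> (tarcs T)\<^sup>+) ?P"
      using down_path_sorted[OF spanned_branch_path[OF T n(2)]] .
    then have "(w, v) \<in> (tarcs T)\<^sup>+" if "w \<in> set p" using that unfolding P by (auto simp: sorted_wrt_append)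
    then have wp: "w \<notin> set p" using vw tree_antisym[OF R vw] 3 by (meson trancl_into_rtrancl)
    obtain ys where "reading T (num_leaves ds) = reading T (Suc n) @ ys"
      using reading_prefix[of "Suc n" "num_leaves ds" T] n by auto
    then have rd: "reading T (num_leaves ds) = (reading T n @ p @ [v]) @ (q @ ys)"
      by (simp add: reading_Suc P)
    have "w \<in> set q" using inP(2) wp 3 unfolding P by auto
    then have "first_pos (reading T (num_leaves ds)) v < first_pos (reading T (num_leaves ds)) w"
      unfolding rd using out wp 3 by (intro first_pos_less) auto
    then show ?thesis unfolding vertex_le_def by simp
  qed
qed

lemma vertex_le_trans: "vertex_le ds T u v \<Longrightarrow> vertex_le ds T v w \<Longrightarrow> vertex_le ds T u w"
  unfolding vertex_le_def by linarith

lemma vertex_le_refl: "vertex_le ds T u u"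
  unfolding vertex_le_def by simp

text \<open>\<open>vertex_le\<close> compares first positions and so is only a preorder in general.
  On the vertices of the tree these positions are distinct, which makes the sorted listing unique
  and the definite description meaningful.\<close>

lemma sorted_listing_eq:
  assumes T: "T \<in> labeled_trees ds" and pos: "\<forall>d \<in> set ds. 1 \<le> d"
    and ws: "set ws \<subseteq> tverts T" "sorted_wrt (vertex_le ds T) ws"
  shows "sorted_listing ds T (mset ws) = ws"
  unfolding sorted_listing_def
proof (rule the_equality)
  let ?f = "first_pos (reading T (num_leaves ds))"
  fix vs assume vs: "mset vs = mset ws \<and> sorted_wrt (vertex_le ds T) vs"
  have sorted: "sorted (map ?f us)" if "sorted_wrt (vertex_le ds T) us" for us
    using that by (simp add: sorted_map vertex_le_def[abs_def])
  have "mset (map ?f vs) = mset (map ?f ws)" using vs by simp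
  then have "map ?f vs = map ?f ws" using sorted vs ws
    by (metis properties_for_sort)
  moreover have "inj_on ?f (set vs \<union> set ws)"
  proof (rule inj_on_subset)
    show "inj_on ?f (tverts T)"
      using vertex_le_antisym[OF T pos] unfolding inj_on_def vertex_le_def by simp
    show "set vs \<union> set ws \<subseteq> tverts T" using vs ws by (metis mset_eq_setD sup.idem)
  qed
  ultimately show "vs = ws" by (simp add: inj_on_map_eq_map)
qed (use ws in simp)

lemma sorted_listing_exists: "\<exists>ws. mset ws = W \<and> sorted_wrt (vertex_le ds T) ws"
proof -
  let ?f = "first_pos (reading T (num_leaves ds))"
  obtain xs where xs: "mset xs = W" using ex_mset by blast
  have "sorted (map ?f (sort_key ?f xs))" by simp
  then have "sorted_wrt (vertex_le ds T) (sort_key ?f xs)"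
    by (simp add: sorted_map vertex_le_def[abs_def])
  then show ?thesis using xs by (metis mset_sort)
qed

section \<open>The growth procedure is a bijection\<close>

lemma children_verts: "rooted_tree T \<Longrightarrow> children T u \<subseteq> tverts T"
  unfolding children_def using tree_arc_verts by fastforce

lemma finite_children: "rooted_tree T \<Longrightarrow> finite (children T u)"
  using children_verts tree_finite finite_subset by metis

lemma children_iff: "v \<in> children T u \<longleftrightarrow> (u, v) \<in> tarcs T"
  unfolding children_def by simp

text \<open>All degree conditions become child counts, so a growth step can be checked by one
  formula per vertex. An infinite child set would also count as 0; finiteness of rooted trees
  excludes it.\<close>

lemma labeled_trees_iff:
  "T \<in> labeled_trees ds \<longleftrightarrow> rooted_tree T \<and>
     tverts T = Node ` {1..length ds} \<union> Leaf ` {1..num_leaves ds} \<and>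
     (\<forall>i \<in> {1..length ds}. card (children T (Node i)) = ds ! (i - 1)) \<and>
     (\<forall>i. card (children T (Leaf i)) = 0)"
proof
  assume "T \<in> labeled_trees ds"
  from labeled_treesD[OF this] show "rooted_tree T \<and>
     tverts T = Node ` {1..length ds} \<union> Leaf ` {1..num_leaves ds} \<and>
     (\<forall>i \<in> {1..length ds}. card (children T (Node i)) = ds ! (i - 1)) \<and>
     (\<forall>i. card (children T (Leaf i)) = 0)" by simp
next
  assume *: "rooted_tree T \<and>
     tverts T = Node ` {1..length ds} \<union> Leaf ` {1..num_leaves ds} \<and>
     (\<forall>i \<in> {1..length ds}. card (children T (Node i)) = ds ! (i - 1)) \<and>
     (\<forall>i. card (children T (Leaf i)) = 0)"
  then have "finite (children T (Leaf i))" for i by (simp add: finite_children)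
  then show "T \<in> labeled_trees ds" using * unfolding labeled_trees_def by simp
qed

section \<open>Single growth steps and child counts\<close>

definition move :: "'v \<Rightarrow> 'v \<Rightarrow> 'v \<Rightarrow> 'v \<Rightarrow> 'v rtree \<Rightarrow> 'v rtree" where
  "move w x v l T = add_leaf v l (reparent w x T)"

lemma move_simps [simp]:
  "tverts (move w x v l T) = insert l (tverts T)"
  "troot (move w x v l T) = troot T"
  "tarcs (move w x v l T) = insert (v, l) (insert (x, w) {(a, b) \<in> tarcs T. b \<noteq> w})"
  by (auto simp: move_def)

lemma children_move:
  "children (move w x v l T) u =
     (if u = v then {l} else {}) \<union> (if u = x then {w} else {}) \<union> (children T u - {w})"
  unfolding children_def by auto

text \<open>The old parent \<open>v\<close> loses \<open>w\<close> and gains \<open>l\<close>, so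
  its count is unchanged and only \<open>x\<close> gains a child.\<close>

lemma card_children_move:
  assumes T: "rooted_tree T" and v: "(v, w) \<in> tarcs T" and x: "v \<noteq> x" and l: "l \<notin> tverts T"
  shows "card (children (move w x v l T) u) = (if u = x then Suc else id) (card (children T u))"
proof -
  note fin = finite_children[OF T]
  have w: "w \<in> children T u \<longleftrightarrow> u = v" for u
    using v tree_parent_unique[OF T v] unfolding children_iff by blast
  have lc: "l \<notin> children T u" for u using children_verts[OF T] l by blast
  consider "u = v" | "u = x" | "u \<noteq> v" "u \<noteq> x" by blast
  then show ?thesis
  proof cases
    case 1
    then have "children (move w x v l T) u = insert l (children T u - {w})"
      using x by (auto simp: children_move)
    moreover have "card (children T u) > 0" using 1 w fin card_gt_0_iff by blast
    ultimately show ?thesis using 1 x w lc fin by simp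
  next
    case 2
    then have "children (move w x v l T) u = insert w (children T u)"
      using x by (auto simp: children_move)
    then show ?thesis using 2 x w fin by simp
  next
    case 3
    then have "children (move w x v l T) u = children T u"
      using w by (auto simp: children_move)
    then show ?thesis using 3 by simp
  qed
qed

text \<open>Positive degrees give every internal node a child, so a labeled leaf lies below each
  vertex. The open interval in \<open>new_leaves k\<close> yields k - 1 labels, as many as are added
  when the last degree is k.\<close>

locale growth =
  fixes ds :: "nat list"
  assumes pos: "\<forall>d \<in> set ds. 1 \<le> d"
begin

abbreviation "L \<equiv> num_leaves ds"
abbreviation "x \<equiv> Node (length ds + 1)"
abbreviation "new_leaves k \<equiv> Leaf ` {L<..<L + k}"

lemma num_leaves_snoc: "num_leaves (ds @ [k]) = L + (k - 1)"
  unfolding num_leaves_def by simp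

lemma x_notin: "T \<in> labeled_trees ds \<Longrightarrow> x \<notin> tverts T"
  using labeled_treesD(2) by auto

lemma labeled_trees_snoc_verts:
  assumes "T' \<in> labeled_trees (ds @ [k])" "1 \<le> k" "T \<in> labeled_trees ds"
  shows "tverts T' = insert x (tverts T \<union> new_leaves k)"
proof -
  have "{1..L + (k - 1)} = {1..L} \<union> {L<..<L + k}" using assms(2) by auto
  then show ?thesis
    unfolding labeled_treesD(2)[OF assms(1)] labeled_treesD(2)[OF assms(3)] num_leaves_snoc
    by (auto simp: atLeastAtMostSuc_conv)
qed

text \<open>An equivalence, because the same child count is used forwards when growing by one step
  and backwards when a step is undone for surjectivity.\<close>

lemma labeled_trees_snoc_Suc_iff:
  assumes T: "rooted_tree T" and T': "rooted_tree T'" and k: "1 \<le> k"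
    and V: "tverts T' = insert (Leaf (L + k)) (tverts T)" "Leaf (L + k) \<notin> tverts T"
    and c: "\<And>u. card (children T' u) = (if u = x then Suc else id) (card (children T u))"
  shows "T' \<in> labeled_trees (ds @ [Suc k]) \<longleftrightarrow> T \<in> labeled_trees (ds @ [k])"
proof -
  have "{1..L + (Suc k - 1)} = insert (L + k) {1..L + (k - 1)}" using k by auto
  then have *: "Leaf ` {1..L + (Suc k - 1)} = insert (Leaf (L + k)) (Leaf ` {1..L + (k - 1)})"
    by simp
  have n: "Leaf (L + k) \<notin> Node ` A \<union> Leaf ` {1..L + (k - 1)}" for A using k by auto
  have v: "tverts T' = Node ` {1..length (ds @ [Suc k])} \<union> Leaf ` {1..num_leaves (ds @ [Suc k])} \<longleftrightarrow>
    tverts T = Node ` {1..length (ds @ [k])} \<union> Leaf ` {1..num_leaves (ds @ [k])}"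
    unfolding V(1) num_leaves_snoc * using V(2) n[of "{1..length (ds @ [k])}"]
    by (simp add: insert_ident)
  have d: "(\<forall>i \<in> {1..length (ds @ [Suc k])}. card (children T' (Node i)) = (ds @ [Suc k]) ! (i - 1)) \<longleftrightarrow>
    (\<forall>i \<in> {1..length (ds @ [k])}. card (children T (Node i)) = (ds @ [k]) ! (i - 1))"
    unfolding c by (intro ball_cong) (auto simp: nth_append)
  show ?thesis unfolding labeled_trees_iff v d using T T' c by auto
qed

lemma labeled_trees_snoc_1_iff:
  assumes T: "rooted_tree T" and T': "rooted_tree T'"
    and V: "tverts T' = insert x (tverts T)" "x \<notin> tverts T"
    and c: "\<And>u. u \<noteq> x \<Longrightarrow> card (children T' u) = card (children T u)" "card (children T' x) = 1"
  shows "T' \<in> labeled_trees (ds @ [1]) \<longleftrightarrow> T \<in> labeled_trees ds"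
proof -
  have *: "Node ` {1..length (ds @ [1])} = insert x (Node ` {1..length ds})"
    by (auto simp: atLeastAtMostSuc_conv)
  have n: "x \<notin> Node ` {1..length ds} \<union> Leaf ` A" for A by auto
  have v: "tverts T' = Node ` {1..length (ds @ [1])} \<union> Leaf ` {1..num_leaves (ds @ [1])} \<longleftrightarrow>
    tverts T = Node ` {1..length ds} \<union> Leaf ` {1..L}"
    unfolding V(1) num_leaves_snoc * using V(2) n[of "{1..L}"]
    by (simp add: insert_ident)
  have d: "(\<forall>i \<in> {1..length (ds @ [1])}. card (children T' (Node i)) = (ds @ [1]) ! (i - 1)) \<longleftrightarrow>
    (\<forall>i \<in> {1..length ds}. card (children T (Node i)) = ds ! (i - 1))"
    using c by (auto simp: nth_append atLeastAtMostSuc_conv)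
  show ?thesis unfolding labeled_trees_iff v d using T T' c by auto
qed

text \<open>With the listing as an argument the inductions are free of the definite description. The
  vertex set follows the length of the listing, so every prefix is a valid input too.\<close>

definition grow_list :: "vertex rtree \<Rightarrow> vertex list \<Rightarrow> vertex rtree" where
  "grow_list T ws = fold (growth_step x L ws) [2..<length ws + 1]
     (insert_above x (ws ! 0) (T\<lparr>tverts := tverts T \<union> {x} \<union> Leaf ` {L + 1..L + length ws - 1}\<rparr>))"

definition sorted_in :: "vertex rtree \<Rightarrow> vertex list \<Rightarrow> bool" where
  "sorted_in T ws \<longleftrightarrow> T \<in> labeled_trees ds \<and> set ws \<subseteq> tverts T \<and> sorted_wrt (vertex_le ds T) ws"

lemma grow_eq_grow_list:
  assumes "sorted_in T ws"
  shows "grow ds T (mset ws) = grow_list T ws"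
  using assms unfolding grow_def grow_list_def sorted_in_def
  by (simp add: Let_def sorted_listing_eq[OF _ pos])

text \<open>The procedure never consults the vertex set, so it commutes with replacing it. This
  reconciles adding all vertices in advance with an induction on prefixes.\<close>

lemma insert_above_tverts:
  "insert_above y w (T\<lparr>tverts := V\<rparr>) = (insert_above y w T)\<lparr>tverts := V\<rparr>"
  unfolding insert_above_def parent_def Let_def by simp

lemma growth_step_tverts:
  "growth_step y n ws j (T\<lparr>tverts := V\<rparr>) = (growth_step y n ws j T)\<lparr>tverts := V\<rparr>"
  unfolding growth_step_def move_below_def parent_def Let_def by simp

lemma fold_growth_step_tverts:
  "fold (growth_step y n ws) js (T\<lparr>tverts := V\<rparr>) = (fold (growth_step y n ws) js T)\<lparr>tverts := V\<rparr>"
  by (induction js arbitrary: T) (simp_all add: growth_step_tverts)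

lemma tverts_grow_list:
  "tverts (grow_list T ws) = tverts T \<union> {x} \<union> Leaf ` {L + 1..L + length ws - 1}"
  unfolding grow_list_def insert_above_tverts fold_growth_step_tverts by simp

text \<open>Subdividing the edge above \<open>w\<close> amounts to hanging \<open>x\<close> as a
  leaf below the parent and then moving \<open>w\<close> below \<open>x\<close>; both operations are
  known to preserve rooted trees.\<close>

lemma grow_list_single:
  assumes T: "T \<in> labeled_trees ds" and w: "w \<in> tverts T"
  shows "grow_list T [w] = (if w = troot T then add_root x T
     else reparent w x (add_leaf (parent T w) x T))"
proof (rule rtree_eqI)
  have "w \<noteq> x" using x_notin[OF T] w by auto
  then show "tarcs (grow_list T [w]) = tarcs (if w = troot T then add_root x T
     else reparent w x (add_leaf (parent T w) x T))"
    using tree_arc_iff_parent[OF labeled_treesD(1)[OF T] w]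
    unfolding grow_list_def insert_above_tverts by (auto simp: insert_above_def Let_def)
qed (auto simp: tverts_grow_list grow_list_def insert_above_def Let_def)

lemma grow_list_snoc:
  assumes "ws \<noteq> []"
  shows "grow_list T (ws @ [w]) =
    (let T' = grow_list T ws; l = Leaf (L + length ws)
     in if w = last ws then add_leaf x l T' else
       T'\<lparr>tverts := insert l (tverts T'),
          tarcs := (tarcs T' - {(parent T' w, w)}) \<union> {(parent T' w, l), (x, w)}\<rparr>)"
proof -
  let ?k = "length ws"
  define F where "F = fold (growth_step x L ws) [2..<?k + 1] (insert_above x (ws ! 0) T)"
  have k: "?k \<ge> 1" using assms by (cases ws) auto
  have g: "grow_list T ws = F\<lparr>tverts := tverts T \<union> {x} \<union> Leaf ` {L + 1..L + ?k - 1}\<rparr>"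
    unfolding grow_list_def F_def insert_above_tverts fold_growth_step_tverts ..
  have "{L + 1..L + ?k} = insert (L + ?k) {L + 1..L + ?k - 1}" using k by auto
  then have V: "tverts T \<union> {x} \<union> Leaf ` {L + 1..L + ?k} = insert (Leaf (L + ?k)) (tverts (grow_list T ws))"
    by (simp add: tverts_grow_list)
  \<comment> \<open>Steps up to the length of \<open>ws\<close> look only at entries of
    \<open>ws\<close>.\<close>
  have "fold (growth_step x L (ws @ [w])) [2..<?k + 1] S = fold (growth_step x L ws) [2..<?k + 1] S" for S
    by (rule fold_cong) (auto simp: growth_step_def nth_append fun_eq_iff Let_def)
  moreover have "[2..<length (ws @ [w]) + 1] = [2..<?k + 1] @ [?k + 1]" using k by simp
  moreover have "(ws @ [w]) ! 0 = ws ! 0" using assms by (simp add: nth_append)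
  ultimately have "grow_list T (ws @ [w]) = (growth_step x L (ws @ [w]) (?k + 1) F)
      \<lparr>tverts := tverts T \<union> {x} \<union> Leaf ` {L + 1..L + ?k}\<rparr>"
    unfolding grow_list_def F_def insert_above_tverts fold_growth_step_tverts by simp
  also have "\<dots> = (growth_step x L (ws @ [w]) (?k + 1) (grow_list T ws))
      \<lparr>tverts := insert (Leaf (L + ?k)) (tverts (grow_list T ws))\<rparr>"
    unfolding V unfolding g growth_step_tverts by simp
  finally have *: "grow_list T (ws @ [w]) = \<dots>" .
  \<comment> \<open>Step k + 1 compares its vertex with the k-th entry, which in 0-based indexing is
    at position k - 1.\<close>
  have "(ws @ [w]) ! (?k - 1) = last ws" using assms by (simp add: nth_append last_conv_nth)
  then have s: "growth_step x L (ws @ [w]) (?k + 1) S = (if w = last ws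
       then S\<lparr>tarcs := insert (x, Leaf (L + ?k)) (tarcs S)\<rparr>
       else move_below x w (Leaf (L + ?k)) S)" for S
    unfolding growth_step_def by (simp add: nth_append)
  show ?thesis unfolding * s
    by (auto simp: Let_def add_leaf_def move_below_def intro!: rtree_eqI)
qed

text \<open>Once the current tree is known to be rooted, deleting the arc from the parent is the
  same as deleting all arcs into \<open>w\<close>, which is what \<open>move\<close> does.\<close>

lemma grow_list_snoc_move:
  assumes "ws \<noteq> []" "w \<noteq> last ws" and T': "rooted_tree (grow_list T ws)"
    and v: "(v, w) \<in> tarcs (grow_list T ws)" and w: "w \<noteq> Leaf (L + length ws)"
  shows "grow_list T (ws @ [w]) = move w x v (Leaf (L + length ws)) (grow_list T ws)"
proof -
  have "u = v" if "(u, w) \<in> tarcs (grow_list T ws)" for u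
    using tree_parent_unique[OF T' that v] .
  then have "tarcs (grow_list T ws) - {(v, w)} = {(a, b) \<in> tarcs (grow_list T ws). b \<noteq> w}" by auto
  then show ?thesis
    unfolding grow_list_snoc[OF assms(1)] Let_def parent_eq[OF T' v]
    using assms(2) by (intro rtree_eqI) auto
qed

section \<open>Sorted listings and the ancestor relation\<close>

lemma sorted_in_snocD:
  assumes "sorted_in T (ws @ [w])"
  shows "sorted_in T ws" "w \<in> tverts T" "\<And>a. a \<in> set ws \<Longrightarrow> vertex_le ds T a w"
  using assms unfolding sorted_in_def by (auto simp: sorted_wrt_append)

lemma sorted_in_le_last:
  assumes "sorted_in T ws" "a \<in> set ws"
  shows "vertex_le ds T a (last ws)"
proof -
  have "ws \<noteq> []" using assms(2) by auto
  then obtain us b where ws: "ws = us @ [b]" by (metis append_butlast_last_id)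
  show ?thesis using assms vertex_le_refl unfolding ws sorted_in_def by (auto simp: sorted_wrt_append)
qed

lemma sorted_in_below_last:
  assumes s: "sorted_in T ws" and ne: "ws \<noteq> []" and a: "(last ws, a) \<in> (tarcs T)\<^sup>*" "a \<in> set ws"
  shows "a = last ws"
proof -
  have T: "T \<in> labeled_trees ds" "last ws \<in> tverts T" "a \<in> tverts T"
    using s ne a unfolding sorted_in_def by auto
  show ?thesis
    using vertex_le_antisym[OF T(1) pos T(3,2)] vertex_le_ancestor[OF T(1) pos T(2) a(1)]
      sorted_in_le_last[OF s a(2)] by blast
qed

text \<open>The new entry comes strictly after all of \<open>ws\<close>, whereas ancestors come
  first: it cannot be the root, and no earlier entry lies below it. The latter keeps the new node
  out of its subtree.\<close>

lemma sorted_in_snoc_new: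
  assumes s: "sorted_in T (ws @ [w])" and ne: "ws \<noteq> []" and w: "w \<noteq> last ws"
  shows "w \<noteq> troot T" and "(w, a) \<in> (tarcs T)\<^sup>* \<Longrightarrow> a \<notin> set ws" and "w \<notin> set ws"
proof -
  note s' = sorted_in_snocD[OF s]
  have T: "T \<in> labeled_trees ds" and lv: "last ws \<in> tverts T"
    using s' ne unfolding sorted_in_def by auto
  note R = labeled_treesD(1)[OF T]
  have nle: "\<not> vertex_le ds T w (last ws)"
    using vertex_le_antisym[OF T pos s'(2) lv] w s'(3)[of "last ws"] ne by auto
  then show "w \<noteq> troot T"
    using vertex_le_ancestor[OF T pos tree_root[OF R] tree_reach[OF R lv]] by blast
  show *: "a \<notin> set ws" if "(w, a) \<in> (tarcs T)\<^sup>*" for a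
    using that vertex_le_ancestor[OF T pos s'(2)] sorted_in_le_last[OF s'(1), of a] nle vertex_le_trans
    by metis
  show "w \<notin> set ws" using * by blast
qed

text \<open>The local effect of the procedure: arcs and child sets of the input tree are only changed at
  the \<open>ws\<close> and their parents, and each change of a child set leaves the new node or a new leaf behind.\<close>

definition grown :: "vertex rtree \<Rightarrow> vertex list \<Rightarrow> vertex rtree \<Rightarrow> bool" where
  "grown T ws T' \<longleftrightarrow> T' \<in> labeled_trees (ds @ [length ws]) \<and>
     set ws \<subseteq> children T' x \<and> children T' x \<subseteq> set ws \<union> new_leaves (length ws) \<and>
     (\<forall>u. \<forall>v \<in> tverts T - set ws. (u, v) \<in> tarcs T' \<longleftrightarrow> (u, v) \<in> tarcs T) \<and>
     (\<forall>u \<in> tverts T. children T u \<inter> set ws = {} \<longrightarrow> children T' u = children T u) \<and>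
     (\<forall>u \<in> tverts T. children T' u \<inter> insert x (new_leaves (length ws)) = {} \<longrightarrow>
        children T' u = children T u)"

lemma grownD:
  assumes "grown T ws T'"
  shows "T' \<in> labeled_trees (ds @ [length ws])"
    and "set ws \<subseteq> children T' x" and "children T' x \<subseteq> set ws \<union> new_leaves (length ws)"
    and "\<And>u v. v \<in> tverts T \<Longrightarrow> v \<notin> set ws \<Longrightarrow> (u, v) \<in> tarcs T' \<longleftrightarrow> (u, v) \<in> tarcs T"
    and "\<And>u. u \<in> tverts T \<Longrightarrow> children T u \<inter> set ws = {} \<Longrightarrow> children T' u = children T u"
    and "\<And>u. u \<in> tverts T \<Longrightarrow> children T' u \<inter> insert x (new_leaves (length ws)) = {} \<Longrightarrow>
      children T' u = children T u"
proof -
  note g = assms[unfolded grown_def]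
  show "T' \<in> labeled_trees (ds @ [length ws])"
    and "set ws \<subseteq> children T' x" and "children T' x \<subseteq> set ws \<union> new_leaves (length ws)"
    by (simp_all only: g)
  show "(u, v) \<in> tarcs T' \<longleftrightarrow> (u, v) \<in> tarcs T" if "v \<in> tverts T" "v \<notin> set ws" for u v
    using g that by (elim conjE) (metis DiffI)
  show "children T' u = children T u" if "u \<in> tverts T" "children T u \<inter> set ws = {}" for u
    using g that by (elim conjE) metis
  show "children T' u = children T u"
    if "u \<in> tverts T" "children T' u \<inter> insert x (new_leaves (length ws)) = {}" for u
    using g that by (elim conjE) metis
qed

lemma grownI:
  assumes "T' \<in> labeled_trees (ds @ [length ws])"
    and "set ws \<subseteq> children T' x" and "children T' x \<subseteq> set ws \<union> new_leaves (length ws)"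
    and "\<And>u v. v \<in> tverts T \<Longrightarrow> v \<notin> set ws \<Longrightarrow> (u, v) \<in> tarcs T' \<longleftrightarrow> (u, v) \<in> tarcs T"
    and "\<And>u. u \<in> tverts T \<Longrightarrow> children T u \<inter> set ws = {} \<Longrightarrow> children T' u = children T u"
    and "\<And>u. u \<in> tverts T \<Longrightarrow> children T' u \<inter> insert x (new_leaves (length ws)) = {} \<Longrightarrow>
      children T' u = children T u"
  shows "grown T ws T'"
proof -
  have "\<forall>u. \<forall>v \<in> tverts T - set ws. (u, v) \<in> tarcs T' \<longleftrightarrow> (u, v) \<in> tarcs T"
    by (intro allI ballI, erule DiffE, rule assms(4))
  moreover have "\<forall>u \<in> tverts T. children T u \<inter> set ws = {} \<longrightarrow> children T' u = children T u"
    by (intro ballI impI, rule assms(5))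
  moreover have "\<forall>u \<in> tverts T. children T' u \<inter> insert x (new_leaves (length ws)) = {} \<longrightarrow>
      children T' u = children T u"
    by (intro ballI impI, rule assms(6))
  ultimately show ?thesis unfolding grown_def using assms(1-3) by (intro conjI)
qed

lemma grown_desc:
  assumes g: "grown T ws T'" and T: "T \<in> labeled_trees ds" and w: "w \<in> tverts T"
    and d: "\<And>a b. (w, a) \<in> (tarcs T)\<^sup>* \<Longrightarrow> (a, b) \<in> tarcs T \<Longrightarrow> b \<notin> set ws"
  shows "(w, z) \<in> (tarcs T)\<^sup>* \<longleftrightarrow> (w, z) \<in> (tarcs T')\<^sup>*"
proof (rule desc_cong)
  fix u assume u: "(w, u) \<in> (tarcs T)\<^sup>*"
  then have "u \<in> tverts T" by (rule tree_desc_verts[OF labeled_treesD(1)[OF T] w])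
  moreover have "children T u \<inter> set ws = {}" using d[OF u] unfolding children_def by blast
  ultimately show "children T u = children T' u" by (rule grownD(5)[OF g, symmetric])
qed

text \<open>No entry lies strictly below the last one, so no child set in its subtree is
  changed.\<close>

lemma grown_last_desc:
  assumes g: "grown T ws T'" and s: "sorted_in T ws" and ne: "ws \<noteq> []"
  shows "(last ws, z) \<in> (tarcs T')\<^sup>* \<longleftrightarrow> (last ws, z) \<in> (tarcs T)\<^sup>*"
proof -
  have T: "T \<in> labeled_trees ds" "last ws \<in> tverts T" using s ne unfolding sorted_in_def by auto
  note R = labeled_treesD(1)[OF T(1)]
  have "b \<notin> set ws" if "(last ws, a) \<in> (tarcs T)\<^sup>*" "(a, b) \<in> tarcs T" for a b
  proof
    assume "b \<in> set ws"
    then have "b = last ws" using sorted_in_below_last[OF s ne] that by (meson rtrancl.rtrancl_into_rtrancl)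
    then show False using tree_arc_no_back[OF R that(2)] that(1) by blast
  qed
  then show ?thesis using grown_desc[OF g T] by blast
qed

text \<open>A test on the output alone. Every changed child set keeps the new node or a new leaf, so
  a subtree without these vertices is exactly the subtree in the input.\<close>

definition clean :: "nat \<Rightarrow> vertex rtree \<Rightarrow> vertex \<Rightarrow> bool" where
  "clean k T c \<longleftrightarrow> (\<forall>z \<in> insert x (new_leaves k). (c, z) \<notin> (tarcs T)\<^sup>*)"

lemma grown_clean_desc:
  assumes g: "grown T ws T'" and ne: "ws \<noteq> []" and T: "T \<in> labeled_trees ds" and c: "c \<in> tverts T"
    and cl: "clean (length ws) T' c"
  shows "(c, z) \<in> (tarcs T')\<^sup>* \<longleftrightarrow> (c, z) \<in> (tarcs T)\<^sup>*"
proof (rule desc_cong)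
  fix u assume u: "(c, u) \<in> (tarcs T')\<^sup>*"
  note T' = grownD(1)[OF g]
  have V: "tverts T' = insert x (tverts T \<union> new_leaves (length ws))"
    using labeled_trees_snoc_verts[OF T' _ T] ne by (cases ws) auto
  have "u \<in> tverts T'" using tree_desc_verts[OF labeled_treesD(1)[OF T'] _ u] V c by blast
  then have "u \<in> tverts T" using u cl V unfolding clean_def by blast
  moreover have "children T' u \<inter> insert x (new_leaves (length ws)) = {}"
  proof (rule ccontr)
    assume "\<not> ?thesis"
    then obtain b where b: "b \<in> insert x (new_leaves (length ws))" "(u, b) \<in> tarcs T'"
      unfolding children_def by blast
    then have "(c, b) \<in> (tarcs T')\<^sup>*" using u by (meson rtrancl.rtrancl_into_rtrancl)
    then show False using b cl unfolding clean_def by blast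
  qed
  ultimately show "children T' u = children T u" by (rule grownD(6)[OF g])
qed

section \<open>Growth yields trees with the right degrees\<close>

lemma grow_list_single_rooted:
  assumes T: "T \<in> labeled_trees ds" and w: "w \<in> tverts T"
  shows "rooted_tree (grow_list T [w])"
proof (cases "w = troot T")
  case True
  then show ?thesis
    using rooted_tree_add_root[OF labeled_treesD(1)[OF T] x_notin[OF T]] grow_list_single[OF T w] by simp
next
  case False
  note R = labeled_treesD(1)[OF T]
  let ?v = "parent T w"
  let ?T = "add_leaf ?v x T"
  have v: "(?v, w) \<in> tarcs T" using parent_arc[OF R w False] .
  have vV: "?v \<in> tverts T" using tree_arc_verts[OF R v] by simp
  have R1: "rooted_tree ?T" using rooted_tree_add_leaf[OF R vV x_notin[OF T]] .
  \<comment> \<open>The only arc into \<open>x\<close> comes from the parent of \<open>w\<close>, so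
    a path from \<open>w\<close> to \<open>x\<close> would close a cycle.\<close>
  have "(w, x) \<notin> (tarcs ?T)\<^sup>*"
  proof
    assume "(w, x) \<in> (tarcs ?T)\<^sup>*"
    moreover have "w \<noteq> x" using w x_notin[OF T] by auto
    ultimately obtain y where y: "(w, y) \<in> (tarcs ?T)\<^sup>*" "(y, x) \<in> tarcs ?T" by (meson rtranclE)
    have "y = ?v" using tree_parent_unique[OF R1 y(2), of ?v] by simp
    moreover have "(?v, w) \<in> tarcs ?T" using v by simp
    ultimately show False using tree_arc_no_back[OF R1] y by blast
  qed
  then have "rooted_tree (reparent w x ?T)"
    using w False by (intro rooted_tree_reparent[OF R1]) auto
  then show ?thesis using False grow_list_single[OF T w] by simp
qed

lemma grown_single:
  assumes T: "T \<in> labeled_trees ds" and w: "w \<in> tverts T"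
  shows "grown T [w] (grow_list T [w])"
proof -
  note R = labeled_treesD(1)[OF T]
  note R' = grow_list_single_rooted[OF T w]
  have xT: "children T x = {}" "x \<notin> children T u" for u
    using x_notin[OF T] tree_arc_verts[OF R] unfolding children_def by auto
  have wx: "w \<noteq> x" using w x_notin[OF T] by auto
  \<comment> \<open>One formula for both cases: if \<open>w\<close> is the root, no arc enters it
    and the middle alternative is void.\<close>
  have ch: "children (grow_list T [w]) u =
      (if u = x then {w} else if (u, w) \<in> tarcs T then insert x (children T u - {w}) else children T u)" for u
  proof (cases "w = troot T")
    case True
    then show ?thesis using xT tree_no_arc_root[OF R] grow_list_single[OF T w]
      by (auto simp: children_add_root)
  next
    case False
    have "parent T w \<noteq> x"
      using tree_arc_verts[OF R parent_arc[OF R w False]] x_notin[OF T] by auto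
    then show ?thesis
      using False xT grow_list_single[OF T w] tree_arc_iff_parent[OF R w False] wx
      by (auto simp: children_reparent children_add_leaf children_iff)
  qed
  have "card (children (grow_list T [w]) u) = card (children T u)" if "u \<noteq> x" for u
  proof (cases "(u, w) \<in> tarcs T")
    case True
    then have "w \<in> children T u" by (simp add: children_iff)
    then have "card (children T u) > 0" using finite_children[OF R] card_gt_0_iff by blast
    then show ?thesis
      using that True xT finite_children[OF R, of u] \<open>w \<in> children T u\<close> by (simp add: ch)
  qed (use that ch in simp)
  then have "grow_list T [w] \<in> labeled_trees (ds @ [1])"
    using labeled_trees_snoc_1_iff[OF R R' _ x_notin[OF T]] T ch by (auto simp: tverts_grow_list)
  moreover have "(u, v) \<in> tarcs (grow_list T [w]) \<longleftrightarrow> (u, v) \<in> tarcs T" if "v \<in> tverts T - {w}" for u v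
    using ch[of u] that x_notin[OF T] xT(1) by (auto simp: children_iff[symmetric])
  ultimately show ?thesis unfolding grown_def using x_notin[OF T] by (auto simp: ch children_iff)
qed

lemma grown_grow_list: "ws \<noteq> [] \<Longrightarrow> sorted_in T ws \<Longrightarrow> grown T ws (grow_list T ws)"
proof (induction ws rule: rev_nonempty_induct)
  case (single w)
  then show ?case using grown_single by (simp add: sorted_in_def)
next
  case (snoc w ws)
  note s = sorted_in_snocD[OF snoc.prems]
  have g: "grown T ws (grow_list T ws)" using snoc.IH s by blast
  have T: "T \<in> labeled_trees ds" using s unfolding sorted_in_def by blast
  note R = labeled_treesD(1)[OF T]
  let ?k = "length ws"
  let ?l = "Leaf (L + ?k)"
  let ?T = "grow_list T ws"
  let ?T' = "grow_list T (ws @ [w])"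
  have k: "1 \<le> ?k" using snoc.hyps by (cases ws) auto
  note T1 = grownD(1)[OF g]
  note R1 = labeled_treesD(1)[OF T1]
  have V: "tverts ?T = insert x (tverts T \<union> new_leaves ?k)" using labeled_trees_snoc_verts[OF T1 k T] .
  have lT: "?l \<notin> tverts T" using labeled_trees_leaf_mem[OF T] k by auto
  have l: "?l \<notin> tverts ?T" using V lT by auto
  have lc: "?l \<notin> children ?T u" for u using l children_verts[OF R1] by blast
  have nl: "new_leaves (Suc ?k) = insert ?l (new_leaves ?k)"
  proof -
    have "{L<..<L + Suc ?k} = insert (L + ?k) {L<..<L + ?k}" using k by auto
    then show ?thesis by simp
  qed
  show ?case
  proof (cases "w = last ws")
    case True
    then have e: "?T' = add_leaf x ?l ?T" using grow_list_snoc[OF snoc.hyps, of T w] by (simp add: Let_def)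
    have st: "set (ws @ [w]) = set ws" using True snoc.hyps by auto
    have R': "rooted_tree ?T'" unfolding e by (rule rooted_tree_add_leaf[OF R1 _ l]) (simp add: V)
    have ch: "children ?T' u = (if u = x then insert ?l (children ?T u) else children ?T u)" for u
      unfolding e children_add_leaf ..
    have chT: "children ?T' u = children ?T u" if "u \<in> tverts T" for u
      using that x_notin[OF T] ch by auto
    show ?thesis
    proof (rule grownI, unfold st nl length_append_singleton)
      show "?T' \<in> labeled_trees (ds @ [Suc ?k])"
        by (subst labeled_trees_snoc_Suc_iff[OF R1 R' k _ l])
          (use T1 lc finite_children[OF R1] in \<open>auto simp: e children_add_leaf\<close>)
      show "set ws \<subseteq> children ?T' x" "children ?T' x \<subseteq> set ws \<union> insert ?l (new_leaves ?k)"
        using grownD(2,3)[OF g] ch[of x] by auto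
      show "(u, v) \<in> tarcs ?T' \<longleftrightarrow> (u, v) \<in> tarcs T" if "v \<in> tverts T" "v \<notin> set ws" for u v
        using that lT grownD(4)[OF g that] unfolding e by auto
      show "children ?T' u = children T u" if "u \<in> tverts T" "children T u \<inter> set ws = {}" for u
        using grownD(5)[OF g that] chT that by simp
      show "children ?T' u = children T u"
        if u: "u \<in> tverts T" "children ?T' u \<inter> insert x (insert ?l (new_leaves ?k)) = {}" for u
        using grownD(6)[OF g u(1)] chT[OF u(1)] u(2) by auto
    qed
  next
    case False
    note n = sorted_in_snoc_new[OF snoc.prems snoc.hyps False]
    let ?v = "parent T w"
    have vT: "(?v, w) \<in> tarcs T" using parent_arc[OF R s(2) n(1)] .
    \<comment> \<open>Arcs into vertices not yet listed are those of the input, so the parent in the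
      input is still the current parent.\<close>
    then have v: "(?v, w) \<in> tarcs ?T" using grownD(4)[OF g s(2) n(3)] by simp
    have vV: "?v \<in> tverts T" using tree_arc_verts[OF R vT] by simp
    have vx: "?v \<noteq> x" using vV x_notin[OF T] by auto
    have wl: "w \<noteq> ?l" using s(2) lT by auto
    have e: "?T' = move w x ?v ?l ?T"
      using grow_list_snoc_move[OF snoc.hyps False R1 v wl] .
    have wroot: "w \<noteq> troot ?T" using tree_no_arc_root[OF R1] v by auto
    \<comment> \<open>The subtree of \<open>w\<close> is still that of the input, where
      \<open>x\<close> does not occur; hence the move makes no cycle.\<close>
    have "(w, x) \<notin> (tarcs T)\<^sup>*" using tree_desc_verts[OF R s(2)] x_notin[OF T] by blast
    moreover have "b \<notin> set ws" if "(w, a) \<in> (tarcs T)\<^sup>*" "(a, b) \<in> tarcs T" for a b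
      using n(2) that by (meson rtrancl.rtrancl_into_rtrancl)
    ultimately have wx: "(w, x) \<notin> (tarcs ?T)\<^sup>*" using grown_desc[OF g T s(2)] by blast
    have R2: "rooted_tree (reparent w x ?T)"
      using V s(2) wroot by (intro rooted_tree_reparent[OF R1 _ _ _ wx]) auto
    have R': "rooted_tree ?T'"
      unfolding e move_def by (rule rooted_tree_add_leaf[OF R2]) (use l V vV in auto)
    have chx: "children ?T' x = insert w (children ?T x)"
      using vx tree_parent_unique[OF R1 v] by (auto simp: e children_move children_iff)
    have ch: "children ?T' u = (if u = ?v then insert ?l (children ?T u - {w}) else children ?T u)"
      if "u \<in> tverts T" for u
      using that x_notin[OF T] tree_parent_unique[OF R1 v] by (auto simp: e children_move children_iff)
    show ?thesis
    proof (rule grownI, unfold nl length_append_singleton)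
      show "?T' \<in> labeled_trees (ds @ [Suc ?k])"
        by (subst labeled_trees_snoc_Suc_iff[OF R1 R' k _ l])
          (use T1 card_children_move[OF R1 v vx l] in \<open>auto simp: e\<close>)
      show "set (ws @ [w]) \<subseteq> children ?T' x"
        "children ?T' x \<subseteq> set (ws @ [w]) \<union> insert ?l (new_leaves ?k)"
        using grownD(2,3)[OF g] chx by auto
      show "(u, b) \<in> tarcs ?T' \<longleftrightarrow> (u, b) \<in> tarcs T" if "b \<in> tverts T" "b \<notin> set (ws @ [w])" for u b
        using that lT grownD(4)[OF g that(1)] unfolding e by auto
      show "children ?T' u = children T u" if u: "u \<in> tverts T" "children T u \<inter> set (ws @ [w]) = {}" for u
      proof -
        have "u \<noteq> ?v" using vT u(2) by (auto simp: children_iff)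
        then show ?thesis using grownD(5)[OF g u(1)] ch[OF u(1)] u(2) by auto
      qed
      show "children ?T' u = children T u"
        if u: "u \<in> tverts T" "children ?T' u \<inter> insert x (insert ?l (new_leaves ?k)) = {}" for u
      proof -
        have "u \<noteq> ?v" using u(2) ch[OF u(1)] by auto
        then show ?thesis using grownD(6)[OF g u(1)] ch[OF u(1)] u(2) by auto
      qed
    qed
  qed
qed

section \<open>Undoing growth: injectivity\<close>

lemma new_leaves_Suc: "1 \<le> k \<Longrightarrow> new_leaves (Suc k) = insert (Leaf (L + k)) (new_leaves k)"
proof -
  assume "1 \<le> k"
  then have "{L<..<L + Suc k} = insert (L + k) {L<..<L + k}" by auto
  then show ?thesis by simp
qed

text \<open>After the first step \<open>w\<close> is visible as the only child of \<open>x\<close>,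
  and \<open>x\<close> sits exactly where \<open>w\<close> was: contracting \<open>x\<close>
  restores the input.\<close>

lemma inverse_single:
  assumes T: "T \<in> labeled_trees ds" and w: "w \<in> tverts T" and T': "T' = grow_list T [w]"
  shows "children T' x = {w}"
    and "T = (if troot T' = x then del_root w T' else del_leaf x (reparent w (parent T' x) T'))"
proof -
  note R = labeled_treesD(1)[OF T]
  note g = grown_single[OF T w, folded T']
  have R': "rooted_tree T'" using grow_list_single_rooted[OF T w] T' by simp
  have "new_leaves (length [w]) = {}" by auto
  then show "children T' x = {w}" using grownD(2,3)[OF g] by auto
  have xT: "(x, v) \<notin> tarcs T" "(v, x) \<notin> tarcs T" for v
    using x_notin[OF T] tree_arc_verts[OF R] by auto
  have wx: "w \<noteq> x" using w x_notin[OF T] by auto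
  show "T = (if troot T' = x then del_root w T' else del_leaf x (reparent w (parent T' x) T'))"
  proof (cases "w = troot T")
    case True
    then have e: "T' = add_root x T" using T' grow_list_single[OF T w] by simp
    show ?thesis unfolding e
      by (rule rtree_eqI) (use True x_notin[OF T] tree_no_arc_root[OF R] in auto)
  next
    case False
    have v: "(parent T w, w) \<in> tarcs T" using parent_arc[OF R w False] .
    have e: "T' = reparent w x (add_leaf (parent T w) x T)" using False T' grow_list_single[OF T w] by simp
    have "(parent T w, x) \<in> tarcs T'" unfolding e using wx by simp
    then have p: "parent T' x = parent T w" by (rule parent_eq[OF R'])
    have r: "troot T' \<noteq> x" unfolding e using x_notin[OF T] tree_root[OF R] by auto
    show ?thesis unfolding p using r unfolding e
      by (simp, intro rtree_eqI) (use v x_notin[OF T] xT tree_parent_unique[OF R] wx in auto)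
  qed
qed

text \<open>The place of the newest leaf tells which kind of step was made. In the second kind that
  leaf marks the place vacated by \<open>w\<close>; the identity of \<open>w\<close> still enters as
  a parameter and is recovered by \<open>last_max_min_leaf\<close>.\<close>

lemma inverse_snoc:
  assumes s: "sorted_in T (ws @ [w])" and ne: "ws \<noteq> []"
    and T': "T' = grow_list T (ws @ [w])" and l: "l = Leaf (L + length ws)"
  shows "w = last ws \<Longrightarrow> (x, l) \<in> tarcs T' \<and> del_leaf l T' = grow_list T ws"
    and "w \<noteq> last ws \<Longrightarrow> (x, l) \<notin> tarcs T' \<and> reparent w (parent T' l) (del_leaf l T') = grow_list T ws"
proof -
  note s' = sorted_in_snocD[OF s]
  note g = grown_grow_list[OF ne s'(1)]
  have k: "1 \<le> length ws" using ne by (cases ws) auto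
  have T: "T \<in> labeled_trees ds" using s' unfolding sorted_in_def by blast
  note R = labeled_treesD(1)[OF T]
  note T1 = grownD(1)[OF g]
  note R1 = labeled_treesD(1)[OF T1]
  have lT: "l \<notin> tverts T" unfolding l using labeled_trees_leaf_mem[OF T] k by auto
  have lT1: "l \<notin> tverts (grow_list T ws)"
    unfolding l using labeled_trees_leaf_mem[OF T1] num_leaves_snoc k by auto
  then have la: "(u, l) \<notin> tarcs (grow_list T ws)" "(l, u) \<notin> tarcs (grow_list T ws)" for u
    using tree_arc_verts[OF R1] by auto
  show "(x, l) \<in> tarcs T' \<and> del_leaf l T' = grow_list T ws" if "w = last ws"
  proof
    have e: "T' = add_leaf x l (grow_list T ws)"
      using that T' l grow_list_snoc[OF ne, of T w] by (simp add: Let_def)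
    show "(x, l) \<in> tarcs T'" unfolding e by simp
    show "del_leaf l T' = grow_list T ws" unfolding e by (rule rtree_eqI) (use lT1 la in auto)
  qed
  show "(x, l) \<notin> tarcs T' \<and> reparent w (parent T' l) (del_leaf l T') = grow_list T ws" if nl: "w \<noteq> last ws"
  proof
    note n = sorted_in_snoc_new[OF s ne nl]
    let ?v = "parent T w"
    have vT: "(?v, w) \<in> tarcs T" using parent_arc[OF R s'(2) n(1)] .
    then have v: "(?v, w) \<in> tarcs (grow_list T ws)" using grownD(4)[OF g s'(2) n(3)] by simp
    have vx: "?v \<noteq> x" using tree_arc_verts[OF R vT] x_notin[OF T] by auto
    have wl: "w \<noteq> l" using s'(2) lT by auto
    have e: "T' = move w x ?v l (grow_list T ws)"
      unfolding T' l using grow_list_snoc_move[OF ne nl R1 v wl[unfolded l]] .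
    show "(x, l) \<notin> tarcs T'" unfolding e using la vx wl by auto
    have "parent T' l = ?v" unfolding parent_def e using la vx wl by auto
    then show "reparent w (parent T' l) (del_leaf l T') = grow_list T ws"
      unfolding e using v wl lT1 la tree_parent_unique[OF R1] by (intro rtree_eqI) auto
  qed
qed

text \<open>Only the last vertex of the listing is certain to keep its descendants; every other child of the
  new node with no new leaf below it comes from an incomparable vertex of the input tree and is read earlier.\<close>

lemma last_max_min_leaf:
  assumes s: "sorted_in T ws" and ne: "ws \<noteq> []" and T': "T' = grow_list T ws"
    and c: "(x, c) \<in> tarcs T'" "clean (length ws) T' c" "c \<noteq> last ws"
  shows "min_leaf T' c < min_leaf T' (last ws)"
proof -
  note g = grown_grow_list[OF ne s, folded T']
  let ?a = "last ws"
  note T1 = grownD(1)[OF g]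
  note R1 = labeled_treesD(1)[OF T1]
  have T: "T \<in> labeled_trees ds" and sub: "set ws \<subseteq> tverts T" using s unfolding sorted_in_def by auto
  have a: "(x, ?a) \<in> tarcs T'" using subsetD[OF grownD(2)[OF g] last_in_set[OF ne]] by (simp add: children_iff)
  have "c \<in> set ws \<union> new_leaves (length ws)" using grownD(3)[OF g] c(1) by (auto simp: children_iff)
  moreover have "c \<notin> new_leaves (length ws)" using c(2) unfolding clean_def by blast
  ultimately have cw: "c \<in> set ws" by blast
  have V: "c \<in> tverts T" "?a \<in> tverts T" using sub cw ne by auto
  have mc: "min_leaf T' c = min_leaf T c"
    unfolding min_leaf_def using grown_clean_desc[OF g ne T V(1) c(2)] by simp
  have ma: "min_leaf T' ?a = min_leaf T ?a"
    unfolding min_leaf_def using grown_last_desc[OF g s ne] by simp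
  have "(c, Leaf (min_leaf T c)) \<in> (tarcs T')\<^sup>*"
    using min_leaf_below(1)[OF T pos V(1)] grown_clean_desc[OF g ne T V(1) c(2)] by simp
  moreover have "(?a, Leaf (min_leaf T ?a)) \<in> (tarcs T')\<^sup>*"
    using min_leaf_below(1)[OF T pos V(2)] grown_last_desc[OF g s ne] by simp
  \<comment> \<open>Different children of \<open>x\<close> have no leaf in common, so the indices
    differ; if that of the last entry were smaller, this entry would have to precede
    \<open>c\<close>.\<close>
  ultimately have "min_leaf T c \<noteq> min_leaf T ?a"
    using tree_siblings_disjoint[OF R1 c(1) a] c(3) by metis
  moreover have "\<not> min_leaf T ?a < min_leaf T c"
    using vertex_le_if_min_leaf_less[OF T pos V(2,1)] vertex_le_antisym[OF T pos V]
      sorted_in_le_last[OF s cw] c(3) by blast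
  ultimately show ?thesis using mc ma by simp
qed

lemma last_clean:
  assumes s: "sorted_in T ws" and ne: "ws \<noteq> []"
  shows "clean (length ws) (grow_list T ws) (last ws)" "(x, last ws) \<in> tarcs (grow_list T ws)"
proof -
  note g = grown_grow_list[OF ne s]
  have T: "T \<in> labeled_trees ds" and V: "last ws \<in> tverts T" using s ne unfolding sorted_in_def by auto
  have "z \<notin> tverts T" if "z \<in> insert x (new_leaves (length ws))" for z
    using that x_notin[OF T] labeled_trees_leaf_mem[OF T] by auto
  then show "clean (length ws) (grow_list T ws) (last ws)"
    unfolding clean_def using grown_last_desc[OF g s ne] tree_desc_verts[OF labeled_treesD(1)[OF T] V] by blast
  show "(x, last ws) \<in> tarcs (grow_list T ws)" using subsetD[OF grownD(2)[OF g] last_in_set[OF ne]] by (simp add: children_iff)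
qed

text \<open>It suffices to identify the last entries. If the newest leaf does not hang from
  \<open>x\<close> and they differed, each would be a clean child for the other listing, so each
  would have a smaller \<open>min_leaf\<close> than the other.\<close>

lemma grow_list_inj:
  "ws \<noteq> [] \<Longrightarrow> sorted_in T ws \<Longrightarrow> sorted_in S vs \<Longrightarrow> length vs = length ws \<Longrightarrow>
    grow_list T ws = grow_list S vs \<Longrightarrow> T = S \<and> ws = vs"
proof (induction ws arbitrary: vs rule: rev_nonempty_induct)
  case (single w)
  then obtain v where vs: "vs = [v]" by (metis One_nat_def length_0_conv length_Suc_conv length_Cons list.size(3))
  have T: "T \<in> labeled_trees ds" "w \<in> tverts T" and S: "S \<in> labeled_trees ds" "v \<in> tverts S"
    using single.prems vs unfolding sorted_in_def by auto
  have "w = v"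
    using inverse_single(1)[OF T refl] inverse_single(1)[OF S refl] single.prems(4) vs by simp
  moreover have "T = S"
    using inverse_single(2)[OF T refl] inverse_single(2)[OF S refl] single.prems(4) vs \<open>w = v\<close> by metis
  ultimately show ?case using vs by simp
next
  case (snoc w ws)
  have "vs \<noteq> []" using snoc.prems(3) by auto
  then obtain us v where vs: "vs = us @ [v]" by (metis append_butlast_last_id)
  have len: "length us = length ws" using snoc.prems(3) vs by simp
  then have ne: "us \<noteq> []" using snoc.hyps by auto
  define T' where "T' = grow_list T (ws @ [w])"
  define l where "l = Leaf (L + length ws)"
  have T'2: "T' = grow_list S (us @ [v])" and l2: "l = Leaf (L + length us)"
    using snoc.prems(4) vs len unfolding T'_def l_def by simp_all
  note s1 = snoc.prems(1) and s2 = snoc.prems(2)[unfolded vs]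
  note i1 = inverse_snoc[OF s1 snoc.hyps T'_def l_def]
  note i2 = inverse_snoc[OF s2 ne T'2 l2]
  show ?case
  proof (cases "(x, l) \<in> tarcs T'")
    case True
    then have w: "w = last ws" "v = last us" using i1(2) i2(2) by blast+
    then have "grow_list T ws = grow_list S us" using i1(1) i2(1) by metis
    then have "T = S \<and> ws = us"
      using snoc.IH[OF sorted_in_snocD(1)[OF s1] sorted_in_snocD(1)[OF s2] len] by blast
    then show ?thesis using w vs by simp
  next
    case False
    then have w: "w \<noteq> last ws" "v \<noteq> last us" using i1(1) i2(1) by blast+
    have le: "length (us @ [v]) = length (ws @ [w])" using len by simp
    note c1 = last_clean[OF s1, folded T'_def] and c2 = last_clean[OF s2, folded T'2, unfolded le]
    have "v = w"
    proof (rule ccontr)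
      assume "v \<noteq> w"
      then have "min_leaf T' v < min_leaf T' w" "min_leaf T' w < min_leaf T' v"
        using last_max_min_leaf[OF s1 _ T'_def, of v] last_max_min_leaf[OF s2 _ T'2, of w, unfolded le] c1 c2
        by simp_all
      then show False by simp
    qed
    then have "grow_list T ws = grow_list S us" using i1(2) i2(2) w by metis
    then have "T = S \<and> ws = us"
      using snoc.IH[OF sorted_in_snocD(1)[OF s1] sorted_in_snocD(1)[OF s2] len] by blast
    then show ?thesis using \<open>v = w\<close> vs by simp
  qed
qed

section \<open>Surjectivity of growth\<close>

lemma grow_list_surj_1:
  assumes T': "T' \<in> labeled_trees (ds @ [1])"
  shows "\<exists>T w. sorted_in T [w] \<and> grow_list T [w] = T'"
proof -
  note R' = labeled_treesD(1)[OF T']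
  have xV: "x \<in> tverts T'" using labeled_treesD(2)[OF T'] by auto
  have "card (children T' x) = 1" using labeled_treesD(3)[OF T', of "length ds + 1"] by (simp add: nth_append)
  then obtain w where w: "children T' x = {w}" by (meson card_1_singletonE)
  then have xw: "(x, v) \<in> tarcs T' \<longleftrightarrow> v = w" for v by (auto simp: children_def)
  have wV: "w \<in> tverts T'" "w \<noteq> x"
    using xw[of w] tree_arc_verts[OF R', of x w] tree_arc_no_back[OF R', of x w] by auto
  show ?thesis
  proof (cases "troot T' = x")
    case True
    let ?T = "del_root w T'"
    have R: "rooted_tree ?T" using rooted_tree_del_root[OF R'] w True by simp
    have e: "T' = add_root x ?T"
      by (rule rtree_eqI) (use True xV wV xw tree_parent_unique[OF R'] in auto)
    have nT: "w \<notin> children T' u" if "u \<noteq> x" for u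
      using that tree_parent_unique[OF R', of u w x] xw by (auto simp: children_iff)
    have "?T \<in> labeled_trees ds"
      using labeled_trees_snoc_1_iff[OF R R'] T' True xV wV nT w
      by (auto simp: children_del_root insert_absorb)
    moreover have "w \<in> tverts ?T" using wV True by simp
    moreover have "grow_list ?T [w] = T'"
      using grow_list_single[OF calculation] e by simp
    ultimately show ?thesis unfolding sorted_in_def by (intro exI[of _ ?T] exI[of _ w]) simp
  next
    case False
    let ?v = "parent T' x"
    \<comment> \<open>The node \<open>x\<close> is contracted: its child moves up to its parent,
      which leaves \<open>x\<close> as a leaf to be deleted.\<close>
    let ?S = "reparent w ?v T'"
    let ?T = "del_leaf x ?S"
    have v: "(?v, x) \<in> tarcs T'" using parent_arc[OF R' xV False[symmetric]] .
    have vV: "?v \<in> tverts T'" "?v \<noteq> x"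
      using tree_arc_verts[OF R' v] tree_arc_no_back[OF R' v] v by auto
    have wr: "w \<noteq> troot T'" using xw tree_no_arc_root[OF R'] by blast
    have "(x, ?v) \<notin> (tarcs T')\<^sup>*" using tree_arc_no_back[OF R' v] .
    moreover have "(x, w) \<in> tarcs T'" using xw by simp
    ultimately have "(w, ?v) \<notin> (tarcs T')\<^sup>*" by (meson converse_rtrancl_into_rtrancl)
    then have S: "rooted_tree ?S" using rooted_tree_reparent[OF R' wV(1) wr vV(1)] by blast
    have R: "rooted_tree ?T"
    proof (rule rooted_tree_del_leaf[OF S])
      show "x \<noteq> troot ?S" using False by simp
      show "children ?S x = {}" using w vV by (simp add: children_reparent)
    qed
    have nT: "w \<notin> children T' u" if "u \<noteq> x" for u
      using that tree_parent_unique[OF R', of u w x] xw by (auto simp: children_iff)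
    have pT: "x \<in> children T' u \<longleftrightarrow> u = ?v" for u
      using tree_parent_unique[OF R' v, of u] v unfolding children_iff by metis
    have ch: "children ?T u = (if u = ?v then insert w (children T' u - {x}) else children T' u)" if "u \<noteq> x" for u
      using that nT[OF that] pT wV by (auto simp: children_del_leaf children_reparent)
    have cc: "card (children T' u) = card (children ?T u)" if "u \<noteq> x" for u
    proof (cases "u = ?v")
      case True
      have "card (children T' u) > 0" using pT True finite_children[OF R'] card_gt_0_iff by blast
      then show ?thesis using True ch[OF that] nT[OF that] pT[of u] finite_children[OF R', of u] by simp
    qed (use ch[OF that] in simp)
    have T: "?T \<in> labeled_trees ds"
      using labeled_trees_snoc_1_iff[OF R R' _ _ cc] T' xV w by (auto simp: insert_absorb)
    have wT: "w \<in> tverts ?T" using wV by simp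
    have "(?v, w) \<in> tarcs ?T" using wV by simp
    then have p: "parent ?T w = ?v" by (rule parent_eq[OF R])
    have "w \<noteq> troot ?T" using wr by simp
    then have "grow_list ?T [w] = reparent w x (add_leaf ?v x ?T)"
      using grow_list_single[OF T wT] p by simp
    also have "\<dots> = T'"
      by (rule rtree_eqI) (use xV xw v wV tree_parent_unique[OF R'] in auto)
    finally show ?thesis using T wT unfolding sorted_in_def by (intro exI[of _ ?T] exI[of _ w]) simp
  qed
qed

text \<open>Acyclicity keeps \<open>x\<close> out of the subtrees of its children, so only new
  leaves can spoil them, and each new leaf lies below at most one child.\<close>

lemma exists_clean_child:
  assumes T': "T' \<in> labeled_trees (ds @ [k])" and k: "1 \<le> k"
  shows "\<exists>c. (x, c) \<in> tarcs T' \<and> clean k T' c"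
proof (rule ccontr)
  assume none: "\<not> ?thesis"
  note R = labeled_treesD(1)[OF T']
  have "\<exists>z. z \<in> new_leaves k \<and> (c, z) \<in> (tarcs T')\<^sup>*" if "c \<in> children T' x" for c
    using that none tree_arc_no_back[OF R, of x c] unfolding clean_def children_iff by blast
  then obtain f where f: "\<And>c. c \<in> children T' x \<Longrightarrow> f c \<in> new_leaves k \<and> (c, f c) \<in> (tarcs T')\<^sup>*"
    by metis
  have "inj_on f (children T' x)"
  proof (rule inj_onI)
    fix a b assume "a \<in> children T' x" "b \<in> children T' x" "f a = f b"
    then show "a = b" using f[of a] f[of b] tree_siblings_disjoint[OF R, of x a b "f b"]
      by (simp add: children_iff)
  qed
  then have "card (children T' x) \<le> card (new_leaves k)"
    using f by (intro card_inj_on_le[of f]) auto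
  moreover have "card (children T' x) = k"
    using labeled_treesD(3)[OF T', of "length ds + 1"] by (simp add: nth_append)
  moreover have "card (new_leaves k) = k - 1"
    by (subst card_image) (auto simp: inj_on_def)
  ultimately show False using k by simp
qed

lemma sorted_in_snocI:
  assumes "sorted_in T ws" "ws \<noteq> []" "c \<in> tverts T" "vertex_le ds T (last ws) c"
  shows "sorted_in T (ws @ [c])"
proof -
  have "vertex_le ds T a c" if "a \<in> set ws" for a
    using sorted_in_le_last[OF assms(1) that] assms(4) vertex_le_trans by blast
  then show ?thesis using assms unfolding sorted_in_def by (simp add: sorted_wrt_append)
qed

text \<open>The candidate is chosen by smallest leaves in \<open>T'\<close>, but the listing must be
  sorted in the input tree, which becomes available only after the induction hypothesis is applied
  to the tree with \<open>c\<close> put back. Most of the work carries the comparison from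
  \<open>T'\<close> to that input tree.\<close>

lemma grow_list_surj:
  "1 \<le> k \<Longrightarrow> T' \<in> labeled_trees (ds @ [k]) \<Longrightarrow> \<exists>T ws. sorted_in T ws \<and> length ws = k \<and> grow_list T ws = T'"
proof (induction k arbitrary: T' rule: dec_induct)
  case base
  then obtain T w where "sorted_in T [w]" "grow_list T [w] = T'" using grow_list_surj_1 by blast
  then show ?case by (intro exI[of _ T] exI[of _ "[w]"]) simp
next
  case (step k)
  note T' = step.prems
  note R' = labeled_treesD(1)[OF T']
  define l where "l = Leaf (L + k)"
  have k: "1 \<le> k" using step by simp
  have lV: "l \<in> tverts T'" and xV: "x \<in> tverts T'"
    using labeled_treesD(2)[OF T'] k unfolding l_def num_leaves_snoc by auto
  have ll: "children T' l = {}" unfolding l_def using labeled_treesD(4)[OF T'] .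
  have lout: "(l, z) \<notin> tarcs T'" for z using ll by (auto simp: children_def)
  have lx: "l \<noteq> x" unfolding l_def by simp
  have lr: "l \<noteq> troot T'"
    using tree_reach[OF R' xV] lout lx by (metis converse_rtranclE)
  let ?D = "del_leaf l T'"
  have D: "rooted_tree ?D" using rooted_tree_del_leaf[OF R' lr ll] .
  have p: "(parent T' l, l) \<in> tarcs T'" using parent_arc[OF R' lV lr] .
  show ?case
  proof (cases "parent T' l = x")
    case True
    have into: "l \<in> children T' u \<longleftrightarrow> u = x" for u
      using p True tree_parent_unique[OF R' p] by (auto simp: children_iff)
    have "card (children T' u) = (if u = x then Suc else id) (card (children ?D u))" for u
      using into[of u] card_Suc_Diff1[OF finite_children[OF R', of u], of l] by (simp add: children_del_leaf)
    then have "?D \<in> labeled_trees (ds @ [k])"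
      using labeled_trees_snoc_Suc_iff[OF D R' k] T' lV unfolding l_def by (simp add: insert_absorb)
    then obtain T ws where ws: "sorted_in T ws" "length ws = k" "grow_list T ws = ?D" using step.IH by blast
    then have ne: "ws \<noteq> []" using k by auto
    have "last ws \<in> tverts T" using ws(1) ne unfolding sorted_in_def by auto
    then have "sorted_in T (ws @ [last ws])" using sorted_in_snocI[OF ws(1) ne _ vertex_le_refl] by blast
    moreover have "grow_list T (ws @ [last ws]) = add_leaf x l ?D"
      using grow_list_snoc[OF ne, of T "last ws"] ws by (simp add: Let_def l_def)
    moreover have "add_leaf x l ?D = T'"
      by (rule rtree_eqI) (use lV p True tree_parent_unique[OF R' p] in auto)
    ultimately show ?thesis using ws(2) by (intro exI[of _ T] exI[of _ "ws @ [last ws]"]) simp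
  next
    case False
    define v where "v = parent T' l"
    have vl: "(v, l) \<in> tarcs T'" and vx: "v \<noteq> x" using p False unfolding v_def by auto
    define C where "C = {c. (x, c) \<in> tarcs T' \<and> clean (Suc k) T' c}"
    have "C \<noteq> {}" using exists_clean_child[OF T'] k unfolding C_def by simp
    moreover have finC: "finite C"
      by (rule finite_subset[OF _ finite_children[OF R', of x]]) (auto simp: children_iff C_def)
    ultimately have "Max (min_leaf T' ` C) \<in> min_leaf T' ` C" by (intro Max_in) auto
    then obtain c where cC: "c \<in> C" and "min_leaf T' c = Max (min_leaf T' ` C)" by fastforce
    then have cmax: "min_leaf T' a \<le> min_leaf T' c" if "a \<in> C" for a using that finC by simp
    have c: "(x, c) \<in> tarcs T'" "clean (Suc k) T' c" using cC unfolding C_def by auto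
    note nl = new_leaves_Suc[OF k, folded l_def]
    have cV: "c \<in> tverts T'" using tree_arc_verts[OF R' c(1)] by simp
    have cl: "(c, l) \<notin> (tarcs T')\<^sup>*" and cx: "(c, x) \<notin> (tarcs T')\<^sup>*"
      using c(2) unfolding clean_def nl by auto
    have cnl: "c \<noteq> l" "c \<noteq> x" using cl cx by auto
    \<comment> \<open>Otherwise the newest leaf, a child of \<open>v\<close>, would lie below
      \<open>c\<close>. Hence \<open>c\<close> can be put back below \<open>v\<close> without a
      cycle.\<close>
    have cv: "(c, v) \<notin> (tarcs T')\<^sup>*" using cl vl by (meson rtrancl.rtrancl_into_rtrancl)
    have vV: "v \<in> tverts ?D" using tree_arc_verts[OF R' vl] lout vl by auto
    have "(c, v) \<notin> (tarcs ?D)\<^sup>*"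
      using cv rtrancl_mono[of "tarcs ?D" "tarcs T'"] by auto
    moreover have "c \<noteq> troot T'" using c(1) tree_no_arc_root[OF R'] by auto
    ultimately have S: "rooted_tree (reparent c v ?D)"
      using rooted_tree_reparent[OF D _ _ vV] cV cnl by simp
    define S where "S = reparent c v ?D"
    note RS = S[folded S_def]
    have vc: "(v, c) \<in> tarcs S" unfolding S_def by simp
    have lS: "l \<notin> tverts S" unfolding S_def by simp
    have e: "T' = move c x v l S" unfolding S_def
      by (rule rtree_eqI) (use lV vl c(1) tree_parent_unique[OF R'] cnl in auto)
    have "S \<in> labeled_trees (ds @ [k])"
    proof (subst labeled_trees_snoc_Suc_iff[OF RS R' k _ _, symmetric])
      show "tverts T' = insert (Leaf (L + k)) (tverts S)" "Leaf (L + k) \<notin> tverts S"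
        using lS e unfolding l_def by (metis move_simps(1), simp)
      show "card (children T' u) = (if u = x then Suc else id) (card (children S u))" for u
        using card_children_move[OF RS vc vx lS] e by metis
    qed (rule T')
    then obtain T ws where ws: "sorted_in T ws" "length ws = k" "grow_list T ws = S"
      using step.IH by blast
    then have ne: "ws \<noteq> []" using k by auto
    note g = grown_grow_list[OF ne ws(1), unfolded ws(3)]
    have T: "T \<in> labeled_trees ds" using ws(1) unfolding sorted_in_def by blast
    note Rt = labeled_treesD(1)[OF T]
    have "tverts T' = insert x (tverts T \<union> new_leaves (Suc k))"
      using labeled_trees_snoc_verts[OF T' _ T] by simp
    then have cT: "c \<in> tverts T" using cV c(2) unfolding clean_def by blast
    have chS: "children S u = children T' u" if "u \<noteq> x" "u \<noteq> v" for u
      using that tree_parent_unique[OF R' c(1)] tree_parent_unique[OF R' vl]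
      unfolding S_def by (auto simp: children_reparent children_del_leaf children_iff)
    let ?a = "last ws"
    have a: "(x, ?a) \<in> tarcs S" and aclean: "clean k S ?a" using last_clean[OF ws(1) ne] ws(2,3) by auto
    have ca: "c \<noteq> ?a" using tree_parent_unique[OF RS vc] a vx by blast
    have aT: "?a \<in> tverts T" using ws(1) ne unfolding sorted_in_def by auto
    have le: "vertex_le ds T ?a c"
    \<comment> \<open>If \<open>c\<close> goes back below the last entry, the subtrees of this entry
      in \<open>S\<close> and \<open>T'\<close> differ and cannot be compared, but then the ancestor
      rule decides. Otherwise the subtrees of both vertices are the same in \<open>S\<close> and
      \<open>T'\<close>.\<close>
    proof (cases "(?a, c) \<in> (tarcs S)\<^sup>*")
      case True
      then show ?thesis
        using grown_last_desc[OF g ws(1) ne] vertex_le_ancestor[OF T pos aT] by blast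
    next
      case False
      have dc: "(c, z) \<in> (tarcs T')\<^sup>* \<longleftrightarrow> (c, z) \<in> (tarcs S)\<^sup>*" for z
        by (rule desc_cong, rule chS[symmetric]) (use cx cv in auto)
      have da: "(?a, z) \<in> (tarcs S)\<^sup>* \<longleftrightarrow> (?a, z) \<in> (tarcs T')\<^sup>*" for z
      proof (rule desc_cong, rule chS)
        fix u assume u: "(?a, u) \<in> (tarcs S)\<^sup>*"
        show "u \<noteq> x" using u aclean unfolding clean_def by auto
        show "u \<noteq> v" using u False vc by (meson rtrancl.rtrancl_into_rtrancl)
      qed
      have aT': "(x, ?a) \<in> tarcs T'" using a ca e by auto
      have "(?a, l) \<notin> (tarcs S)\<^sup>*"
        using lS tree_desc_verts[OF RS, of ?a l] tree_arc_verts[OF RS a] by blast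
      \<comment> \<open>So the last entry is itself a candidate, and the choice of \<open>c\<close>
        gives the weak inequality; disjointness of the two subtrees makes it strict.\<close>
      then have "clean (Suc k) T' ?a" using aclean da unfolding clean_def nl by auto
      then have "min_leaf T' ?a \<le> min_leaf T' c" using cmax[of ?a] aT' unfolding C_def by blast
      moreover have "min_leaf T' ?a = min_leaf T ?a"
        unfolding min_leaf_def using grown_last_desc[OF g ws(1) ne] da by simp
      moreover have cS: "clean (length ws) S c" using c(2) dc ws(2) unfolding clean_def nl by auto
      moreover have dcT: "(c, z) \<in> (tarcs T')\<^sup>* \<longleftrightarrow> (c, z) \<in> (tarcs T)\<^sup>*" for z
        using grown_clean_desc[OF g ne T cT cS] dc by simp
      moreover have "min_leaf T' c = min_leaf T c" unfolding min_leaf_def using dcT by simp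
      moreover have "min_leaf T c \<noteq> min_leaf T ?a"
      proof
        assume eq: "min_leaf T c = min_leaf T ?a"
        have "(c, Leaf (min_leaf T c)) \<in> (tarcs T')\<^sup>*"
          using min_leaf_below(1)[OF T pos cT] dcT by simp
        moreover have "(?a, Leaf (min_leaf T ?a)) \<in> (tarcs T')\<^sup>*"
          using min_leaf_below(1)[OF T pos aT] grown_last_desc[OF g ws(1) ne] da by simp
        ultimately show False using tree_siblings_disjoint[OF R' c(1) aT'] ca eq by metis
      qed
      ultimately have "min_leaf T ?a < min_leaf T c" by simp
      then show ?thesis using vertex_le_if_min_leaf_less[OF T pos aT cT] by blast
    qed
    have "grow_list T (ws @ [c]) = move c x v l S"
      using grow_list_snoc_move[OF ne ca, of T v] RS vc cnl ws(2,3) unfolding l_def by simp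
    then show ?thesis
      using sorted_in_snocI[OF ws(1) ne cT le] e ws(2) by (intro exI[of _ T] exI[of _ "ws @ [c]"]) simp
  qed
qed

theorem bij_betw_grow:
  assumes d: "1 \<le> d"
  shows "bij_betw (\<lambda>(T, W). grow ds T W)
    (SIGMA T : labeled_trees ds. multisets_of_size (tverts T) d) (labeled_trees (ds @ [d]))"
proof -
  have sorted: "\<exists>T ws. X = (T, mset ws) \<and> sorted_in T ws \<and> length ws = d"
    if X: "X \<in> (SIGMA T : labeled_trees ds. multisets_of_size (tverts T) d)" for X
  proof -
    obtain T W where TW: "X = (T, W)" by (cases X)
    obtain ws where "mset ws = W" "sorted_wrt (vertex_le ds T) ws" using sorted_listing_exists by blast
    then show ?thesis
      using X unfolding TW sorted_in_def multisets_of_size_def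
      by (intro exI[of _ T] exI[of _ ws]) auto
  qed
  show ?thesis
  proof (rule bij_betwI')
    fix X Y assume X: "X \<in> (SIGMA T : labeled_trees ds. multisets_of_size (tverts T) d)"
      and Y: "Y \<in> (SIGMA T : labeled_trees ds. multisets_of_size (tverts T) d)"
    obtain T ws where T: "X = (T, mset ws)" "sorted_in T ws" "length ws = d" using sorted[OF X] by blast
    obtain S vs where S: "Y = (S, mset vs)" "sorted_in S vs" "length vs = d" using sorted[OF Y] by blast
    have "ws \<noteq> []" using T(3) d by auto
    then have "grow_list T ws = grow_list S vs \<Longrightarrow> X = Y"
      using grow_list_inj[OF _ T(2) S(2)] T S by auto
    then show "(case X of (T, W) \<Rightarrow> grow ds T W) = (case Y of (T, W) \<Rightarrow> grow ds T W) \<longleftrightarrow> X = Y"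
      using grow_eq_grow_list[OF T(2)] grow_eq_grow_list[OF S(2)] T(1) S(1) by auto
  next
    fix X assume X: "X \<in> (SIGMA T : labeled_trees ds. multisets_of_size (tverts T) d)"
    obtain T ws where T: "X = (T, mset ws)" "sorted_in T ws" "length ws = d" using sorted[OF X] by blast
    then have "ws \<noteq> []" using d by auto
    then show "(case X of (T, W) \<Rightarrow> grow ds T W) \<in> labeled_trees (ds @ [d])"
      using grownD(1)[OF grown_grow_list] T grow_eq_grow_list by auto
  next
    fix T' assume "T' \<in> labeled_trees (ds @ [d])"
    then obtain T ws where ws: "sorted_in T ws" "length ws = d" "grow_list T ws = T'"
      using grow_list_surj[OF d] by blast
    then have "(T, mset ws) \<in> (SIGMA T : labeled_trees ds. multisets_of_size (tverts T) d)"
      unfolding sorted_in_def multisets_of_size_def by auto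
    then show "\<exists>X \<in> (SIGMA T : labeled_trees ds. multisets_of_size (tverts T) d).
        T' = (case X of (T, W) \<Rightarrow> grow ds T W)"
      using grow_eq_grow_list[OF ws(1)] ws(3) by (intro bexI[of _ "(T, mset ws)"]) auto
  qed
qed

end

section \<open>Uniformity of the labeled trees\<close>

lemma finite_labeled_trees: "finite (labeled_trees ds)"
proof (rule finite_subset)
  let ?V = "Node ` {1..length ds} \<union> Leaf ` {1..num_leaves ds}"
  show "labeled_trees ds \<subseteq> (\<lambda>(r, A). \<lparr>tverts = ?V, troot = r, tarcs = A\<rparr>) ` (?V \<times> Pow (?V \<times> ?V))"
  proof
    fix T assume "T \<in> labeled_trees ds"
    then have "T = (\<lambda>(r, A). \<lparr>tverts = ?V, troot = r, tarcs = A\<rparr>) (troot T, tarcs T)"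
      "(troot T, tarcs T) \<in> ?V \<times> Pow (?V \<times> ?V)"
      unfolding labeled_trees_def rooted_tree_def by auto
    then show "T \<in> (\<lambda>(r, A). \<lparr>tverts = ?V, troot = r, tarcs = A\<rparr>) ` (?V \<times> Pow (?V \<times> ?V))"
      by (rule image_eqI)
  qed
qed auto

lemma pair_pmf_of_set:
  assumes "finite A" "A \<noteq> {}" "finite B" "B \<noteq> {}"
  shows "pair_pmf (pmf_of_set A) (pmf_of_set B) = pmf_of_set (A \<times> B)"
proof (rule pmf_eqI)
  fix z
  show "pmf (pair_pmf (pmf_of_set A) (pmf_of_set B)) z = pmf (pmf_of_set (A \<times> B)) z"
    using assms by (cases z) (auto simp: pmf_pair indicator_def card_cartesian_product)
qed

lemma multisets_of_size_singleton: "multisets_of_size {a} n = {replicate_mset n a}"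
  unfolding multisets_of_size_def by (auto dest: set_mset_subset_singletonD simp: set_mset_replicate_mset_subset split: if_splits)

text \<open>The bijection is also applied to the empty degree sequence: one tree with one vertex
  admits one multiset, so \<open>labeled_trees [d]\<close> is a singleton and the initial
  \<open>the_elem\<close> is justified.\<close>

lemma labeled_trees_Nil: "labeled_trees [] = {\<lparr>tverts = {Leaf 1}, troot = Leaf 1, tarcs = {}\<rparr>}"
proof
  show "labeled_trees [] \<subseteq> {\<lparr>tverts = {Leaf 1}, troot = Leaf 1, tarcs = {}\<rparr>}"
  proof
    fix T assume T: "T \<in> labeled_trees []"
    have V: "tverts T = {Leaf 1}" using labeled_treesD(2)[OF T] by (simp add: num_leaves_def)
    moreover have r: "troot T = Leaf 1" using tree_root[OF labeled_treesD(1)[OF T]] V by simp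
    moreover have "tarcs T = {}"
      using tree_arc_verts[OF labeled_treesD(1)[OF T]] tree_no_arc_root[OF labeled_treesD(1)[OF T]] V r by auto
    ultimately show "T \<in> {\<lparr>tverts = {Leaf 1}, troot = Leaf 1, tarcs = {}\<rparr>}" by (auto intro: rtree_eqI)
  qed
  show "{\<lparr>tverts = {Leaf 1}, troot = Leaf 1, tarcs = {}\<rparr>} \<subseteq> labeled_trees []"
    by (simp add: labeled_trees_def rooted_tree_def num_leaves_def children_def)
qed

lemma growth_replicate: "1 \<le> d \<Longrightarrow> growth (replicate n d)"
  by unfold_locales simp

text \<open>The vertex set depends on the degrees alone, so the dependent sum is a product, and
  independent uniform choices are uniform on it.\<close>

lemma bij_betw_grow_replicate:
  assumes d: "1 \<le> d"
  shows "bij_betw (\<lambda>(T, W). grow (replicate n d) T W)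
    (labeled_trees (replicate n d) \<times>
      multisets_of_size (Node ` {1..n} \<union> Leaf ` {1..num_leaves (replicate n d)}) d)
    (labeled_trees (replicate (Suc n) d))"
proof -
  have "replicate n d @ [d] = replicate (Suc n) d" by (simp add: replicate_append_same)
  moreover have "(SIGMA T : labeled_trees (replicate n d). multisets_of_size (tverts T) d) =
    labeled_trees (replicate n d) \<times>
      multisets_of_size (Node ` {1..n} \<union> Leaf ` {1..num_leaves (replicate n d)}) d"
    using labeled_treesD(2)[of _ "replicate n d"] by (intro Sigma_cong) auto
  ultimately show ?thesis using growth.bij_betw_grow[OF growth_replicate[OF d, of n] d] by metis
qed

text \<open>Nonemptiness travels along the induction because \<open>pmf_of_set\<close> has its
  meaning only on nonempty finite sets.\<close>

lemma growth_law_eq_pmf_of_set: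
  assumes d: "1 \<le> d"
  shows "growth_law d (Suc n) = pmf_of_set (labeled_trees (replicate (Suc n) d)) \<and>
    labeled_trees (replicate (Suc n) d) \<noteq> {}"
proof (induction n)
  case 0
  have V: "Node ` {1..0} \<union> Leaf ` {1..num_leaves (replicate 0 d)} = {Leaf 1}"
    by (simp add: num_leaves_def)
  have "bij_betw (\<lambda>(T, W). grow [] T W) (labeled_trees [] \<times> {replicate_mset d (Leaf 1)}) (labeled_trees [d])"
    using bij_betw_grow_replicate[OF d, of 0] unfolding V multisets_of_size_singleton by simp
  then obtain T where "labeled_trees [d] = {T}"
    unfolding labeled_trees_Nil bij_betw_def by auto
  then show ?case by (simp add: pmf_of_set_singleton)
next
  case (Suc n)
  let ?ds = "replicate (Suc n) d"
  let ?A = "labeled_trees ?ds"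
  let ?V = "Node ` {1..Suc n} \<union> Leaf ` {1..num_leaves ?ds}"
  let ?M = "multisets_of_size ?V d"
  have A: "finite ?A" "?A \<noteq> {}" "growth_law d (Suc n) = pmf_of_set ?A"
    using Suc finite_labeled_trees by auto
  have "replicate_mset d (Leaf 1) \<in> ?M"
    unfolding multisets_of_size_def by (auto simp: num_leaves_def dest!: in_replicate_mset[THEN iffD1])
  then have M: "finite ?M" "?M \<noteq> {}" by auto
  note bij = bij_betw_grow_replicate[OF d, of "Suc n"]
  have "growth_law d (Suc (Suc n)) =
      bind_pmf (pmf_of_set ?A) (\<lambda>T. map_pmf (grow ?ds T) (pmf_of_set ?M))"
    unfolding growth_law.simps A(3)
    using A(1,2) labeled_treesD(2)[of _ ?ds] by (intro bind_pmf_cong) auto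
  also have "\<dots> = map_pmf (\<lambda>(T, W). grow ?ds T W) (pair_pmf (pmf_of_set ?A) (pmf_of_set ?M))"
    by (simp add: pair_pmf_def map_pmf_def bind_assoc_pmf bind_return_pmf)
  also have "\<dots> = pmf_of_set (labeled_trees (replicate (Suc (Suc n)) d))"
    unfolding pair_pmf_of_set[OF A(1,2) M] using A M by (intro map_pmf_of_set_bij_betw[OF bij]) auto
  finally have "growth_law d (Suc (Suc n)) = pmf_of_set (labeled_trees (replicate (Suc (Suc n)) d))" .
  moreover have "labeled_trees (replicate (Suc (Suc n)) d) \<noteq> {}"
    using bij_betw_imp_surj_on[OF bij] A(2) M(2) by (metis Times_empty image_is_empty)
  ultimately show ?case by blast
qed

section \<open>Isomorphisms of leaf-labeled trees\<close>

text \<open>Isomorphisms are only required to respect undirected edges and the root; directions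
  follow by induction from the root. A reversed arc would enter the root, or give a vertex a second
  parent and hence identify a child with its grandparent.\<close>

lemma leaf_isomorphism_arcs:
  assumes X: "rooted_tree (fst X)" and Y: "rooted_tree (fst Y)" and i: "leaf_isomorphism \<phi> X Y"
    and u: "u \<in> tverts (fst X)" and v: "v \<in> tverts (fst X)"
  shows "(u, v) \<in> tarcs (fst X) \<longleftrightarrow> (\<phi> u, \<phi> v) \<in> tarcs (fst Y)"
proof -
  have inj: "inj_on \<phi> (tverts (fst X))" and r: "\<phi> (troot (fst X)) = troot (fst Y)"
    and adj: "\<And>u v. u \<in> tverts (fst X) \<Longrightarrow> v \<in> tverts (fst X) \<Longrightarrow>
      adjacent (fst X) u v \<longleftrightarrow> adjacent (fst Y) (\<phi> u) (\<phi> v)"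
    using i unfolding leaf_isomorphism_def bij_betw_def by auto
  have fwd: "(\<phi> a, \<phi> b) \<in> tarcs (fst Y)" if ab: "(a, b) \<in> tarcs (fst X)" for a b
  proof -
    have "(troot (fst X), a) \<in> (tarcs (fst X))\<^sup>*"
      using tree_reach[OF X] tree_arc_verts[OF X ab] by simp
    then show ?thesis using ab
    proof (induction arbitrary: b rule: rtrancl_induct)
      case base
      have "adjacent (fst Y) (troot (fst Y)) (\<phi> b)"
        using adj[of "troot (fst X)" b] tree_arc_verts[OF X base] base r by (simp add: adjacent_def)
      then show ?case using tree_no_arc_root[OF Y] r by (simp add: adjacent_def)
    next
      case (step t a)
      have IH: "(\<phi> t, \<phi> a) \<in> tarcs (fst Y)" using step.IH[OF step(2)] .
      have V: "t \<in> tverts (fst X)" "a \<in> tverts (fst X)" "b \<in> tverts (fst X)"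
        using tree_arc_verts[OF X step(2)] tree_arc_verts[OF X step.prems] by auto
      have "adjacent (fst Y) (\<phi> a) (\<phi> b)" using adj[OF V(2,3)] step.prems by (simp add: adjacent_def)
      moreover have "(\<phi> b, \<phi> a) \<notin> tarcs (fst Y)"
      proof
        assume "(\<phi> b, \<phi> a) \<in> tarcs (fst Y)"
        then have "\<phi> b = \<phi> t" using tree_parent_unique[OF Y _ IH] by blast
        then have "b = t" using inj V unfolding inj_on_def by blast
        then show False using tree_arc_no_back[OF X step(2)] step.prems by blast
      qed
      ultimately show ?case by (simp add: adjacent_def)
    qed
  qed
  show ?thesis
  proof
    assume uv: "(\<phi> u, \<phi> v) \<in> tarcs (fst Y)"
    then have "adjacent (fst X) u v" using adj[OF u v] by (simp add: adjacent_def)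
    moreover have "(v, u) \<notin> tarcs (fst X)" using fwd[of v u] tree_arc_no_back[OF Y uv] by blast
    ultimately show "(u, v) \<in> tarcs (fst X)" by (simp add: adjacent_def)
  qed (rule fwd)
qed

lemma leaf_isomorphism_children:
  assumes X: "rooted_tree (fst X)" and Y: "rooted_tree (fst Y)" and i: "leaf_isomorphism \<phi> X Y"
    and u: "u \<in> tverts (fst X)"
  shows "children (fst Y) (\<phi> u) = \<phi> ` children (fst X) u"
proof -
  have b: "\<phi> ` tverts (fst X) = tverts (fst Y)"
    using i unfolding leaf_isomorphism_def bij_betw_def by auto
  have "w \<in> children (fst Y) (\<phi> u) \<longleftrightarrow> w \<in> \<phi> ` children (fst X) u" for w
  proof
    assume w: "w \<in> children (fst Y) (\<phi> u)"
    then have "w \<in> tverts (fst Y)" using children_verts[OF Y] by blast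
    then obtain v where "w = \<phi> v" "v \<in> tverts (fst X)" using b by blast
    then show "w \<in> \<phi> ` children (fst X) u"
      using w leaf_isomorphism_arcs[OF X Y i u] by (simp add: children_iff)
  next
    assume "w \<in> \<phi> ` children (fst X) u"
    then obtain v where v: "w = \<phi> v" "v \<in> children (fst X) u" by blast
    then have "v \<in> tverts (fst X)" using children_verts[OF X] by blast
    then show "w \<in> children (fst Y) (\<phi> u)"
      using v leaf_isomorphism_arcs[OF X Y i u] by (simp add: children_iff)
  qed
  then show ?thesis by blast
qed

lemma leaf_isomorphism_leaves:
  assumes X: "rooted_tree (fst X)" and Y: "rooted_tree (fst Y)" and i: "leaf_isomorphism \<phi> X Y"
    and u: "u \<in> tverts (fst X)"
  shows "\<phi> u \<in> leaves (fst Y) \<longleftrightarrow> u \<in> leaves (fst X)" "\<phi> u \<in> nonleaves (fst Y) \<longleftrightarrow> u \<in> nonleaves (fst X)"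
proof -
  have "\<phi> u \<in> tverts (fst Y)" using i u unfolding leaf_isomorphism_def bij_betw_def by blast
  then show "\<phi> u \<in> leaves (fst Y) \<longleftrightarrow> u \<in> leaves (fst X)" "\<phi> u \<in> nonleaves (fst Y) \<longleftrightarrow> u \<in> nonleaves (fst X)"
    using leaf_isomorphism_children[OF assms] u unfolding leaves_def nonleaves_def by auto
qed

lemma leaf_isomorphism_id: "leaf_isomorphism (\<lambda>v. v) X X"
  unfolding leaf_isomorphism_def by (simp add: bij_betw_def)

lemma leaf_isomorphism_comp:
  assumes X: "rooted_tree (fst X)" and Y: "rooted_tree (fst Y)"
    and i: "leaf_isomorphism \<phi> X Y" and j: "leaf_isomorphism \<psi> Y Z"
  shows "leaf_isomorphism (\<psi> \<circ> \<phi>) X Z"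
proof -
  have m: "\<phi> v \<in> tverts (fst Y)" if "v \<in> tverts (fst X)" for v
    using i that unfolding leaf_isomorphism_def bij_betw_def by blast
  have l: "\<phi> v \<in> leaves (fst Y)" if "v \<in> leaves (fst X)" for v
    using that leaf_isomorphism_leaves(1)[OF X Y i, of v] unfolding leaves_def by blast
  show ?thesis
    using i j m l unfolding leaf_isomorphism_def by (auto intro: bij_betw_trans)
qed

lemma leaf_isomorphism_inv:
  assumes X: "rooted_tree (fst X)" and Y: "rooted_tree (fst Y)" and i: "leaf_isomorphism \<phi> X Y"
  shows "leaf_isomorphism (inv_into (tverts (fst X)) \<phi>) Y X"
proof -
  let ?\<psi> = "inv_into (tverts (fst X)) \<phi>"
  have b: "bij_betw \<phi> (tverts (fst X)) (tverts (fst Y))" using i unfolding leaf_isomorphism_def by blast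
  have p: "?\<psi> w \<in> tverts (fst X)" "\<phi> (?\<psi> w) = w" if "w \<in> tverts (fst Y)" for w
    using that b by (auto simp: bij_betw_def inv_into_into f_inv_into_f)
  have "?\<psi> (troot (fst Y)) = troot (fst X)"
    using i b tree_root[OF X] unfolding leaf_isomorphism_def by (metis bij_betw_inv_into_left)
  moreover have "snd X (?\<psi> w) = snd Y w" if w: "w \<in> leaves (fst Y)" for w
  proof -
    have wV: "w \<in> tverts (fst Y)" using w unfolding leaves_def by blast
    then have "?\<psi> w \<in> leaves (fst X)"
      using leaf_isomorphism_leaves(1)[OF X Y i p(1)[OF wV]] p(2)[OF wV] w by simp
    then show ?thesis using i p(2)[OF wV] unfolding leaf_isomorphism_def by metis
  qed
  moreover have "adjacent (fst Y) u v \<longleftrightarrow> adjacent (fst X) (?\<psi> u) (?\<psi> v)"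
    if "u \<in> tverts (fst Y)" "v \<in> tverts (fst Y)" for u v
    using i p[OF that(1)] p[OF that(2)] unfolding leaf_isomorphism_def by metis
  ultimately show ?thesis
    unfolding leaf_isomorphism_def using bij_betw_inv_into[OF b] by blast
qed

text \<open>A leaf-labeled tree is rigid: leaves are fixed by their labels, and a vertex by any leaf below it.\<close>

lemma leaf_isomorphism_unique:
  assumes X: "rooted_tree (fst X)" and Y: "rooted_tree (fst Y)" and lab: "inj_on (snd Y) (leaves (fst Y))"
    and i: "leaf_isomorphism \<phi> X Y" and j: "leaf_isomorphism \<psi> X Y" and v: "v \<in> tverts (fst X)"
  shows "\<phi> v = \<psi> v"
proof -
  obtain z where z: "z \<in> leaves (fst X)" "(v, z) \<in> (tarcs (fst X))\<^sup>*" using tree_leaf_below[OF X v] by blast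
  from z(2) show ?thesis
  proof (induction rule: converse_rtrancl_induct)
    case base
    have zV: "z \<in> tverts (fst X)" using z(1) unfolding leaves_def by blast
    have "snd Y (\<phi> z) = snd Y (\<psi> z)" using i j z(1) unfolding leaf_isomorphism_def by metis
    then show ?case
      using lab leaf_isomorphism_leaves(1)[OF X Y i zV] leaf_isomorphism_leaves(1)[OF X Y j zV] z(1)
      unfolding inj_on_def by blast
  next
    case (step u w)
    have "u \<in> tverts (fst X)" "w \<in> tverts (fst X)" using tree_arc_verts[OF X step(1)] by auto
    then have "(\<phi> u, \<phi> w) \<in> tarcs (fst Y)" "(\<psi> u, \<psi> w) \<in> tarcs (fst Y)"
      using leaf_isomorphism_arcs[OF X Y i] leaf_isomorphism_arcs[OF X Y j] step(1) by blast+
    then show ?case using step.IH tree_parent_unique[OF Y] by metis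
  qed
qed

section \<open>Isomorphism as an equivalence and as relabeling\<close>

lemma dary_representatives_rooted: "X \<in> dary_representatives d m \<Longrightarrow> rooted_tree (fst X)"
  unfolding dary_representatives_def by auto

lemma dary_representatives_inj: "X \<in> dary_representatives d m \<Longrightarrow> inj_on (snd X) (leaves (fst X))"
  unfolding dary_representatives_def bij_betw_def by auto

lemma equiv_leaf_iso_rel: "equiv (dary_representatives d m) (leaf_iso_rel d m)"
proof (rule equivI)
  show "leaf_iso_rel d m \<subseteq> dary_representatives d m \<times> dary_representatives d m"
    unfolding leaf_iso_rel_def by auto
  show "refl_on (dary_representatives d m) (leaf_iso_rel d m)"
    unfolding refl_on_def leaf_iso_rel_def using leaf_isomorphism_id by auto
  show "sym (leaf_iso_rel d m)"
    unfolding sym_def leaf_iso_rel_def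
    using leaf_isomorphism_inv dary_representatives_rooted by blast
  show "trans (leaf_iso_rel d m)"
    unfolding trans_def leaf_iso_rel_def
    using leaf_isomorphism_comp dary_representatives_rooted by blast
qed

definition relabel :: "('v \<Rightarrow> 'w) \<Rightarrow> 'v rtree \<Rightarrow> 'w rtree" where
  "relabel f T = \<lparr>tverts = f ` tverts T, troot = f (troot T), tarcs = (\<lambda>(u, v). (f u, f v)) ` tarcs T\<rparr>"

lemma relabel_simps [simp]:
  "tverts (relabel f T) = f ` tverts T"
  "troot (relabel f T) = f (troot T)"
  "tarcs (relabel f T) = (\<lambda>(u, v). (f u, f v)) ` tarcs T"
  by (simp_all add: relabel_def)

lemma relabel_arcs:
  assumes T: "rooted_tree T" and f: "inj_on f (tverts T)" and "u \<in> tverts T" "v \<in> tverts T"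
  shows "(f u, f v) \<in> tarcs (relabel f T) \<longleftrightarrow> (u, v) \<in> tarcs T"
proof
  assume "(f u, f v) \<in> tarcs (relabel f T)"
  then obtain a b where ab: "(a, b) \<in> tarcs T" "f u = f a" "f v = f b" by auto
  then have "u = a" "v = b"
    using tree_arc_verts[OF T ab(1)] assms(3,4) inj_onD[OF f ab(2)] inj_onD[OF f ab(3)] by simp_all
  then show "(u, v) \<in> tarcs T" using ab(1) by simp
qed force

lemma rooted_tree_relabel:
  assumes T: "rooted_tree T" and f: "inj_on f (tverts T)"
  shows "rooted_tree (relabel f T)"
proof (rule rooted_treeI)
  show "finite (tverts (relabel f T))" using tree_finite[OF T] by simp
  show "troot (relabel f T) \<in> tverts (relabel f T)" using tree_root[OF T] by simp
  show "tarcs (relabel f T) \<subseteq> tverts (relabel f T) \<times> tverts (relabel f T)"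
    using tree_arc_verts[OF T] by auto
  show "(u, troot (relabel f T)) \<notin> tarcs (relabel f T)" for u
  proof
    assume "(u, troot (relabel f T)) \<in> tarcs (relabel f T)"
    then obtain a b where ab: "(a, b) \<in> tarcs T" "f b = f (troot T)" by auto
    then have "b = troot T" using f tree_root[OF T] tree_arc_verts[OF T ab(1)] by (auto dest: inj_onD)
    then show False using ab tree_no_arc_root[OF T] by simp
  qed
  show "u = u'" if uu: "(u, v) \<in> tarcs (relabel f T)" "(u', v) \<in> tarcs (relabel f T)" for u u' v
  proof -
    obtain a b where ab: "(a, b) \<in> tarcs T" "u = f a" "v = f b" using uu(1) by auto
    obtain a' b' where ab': "(a', b') \<in> tarcs T" "u' = f a'" "v = f b'" using uu(2) by auto
    have "b = b'"
      using f ab(3) ab'(3) tree_arc_verts[OF T ab(1)] tree_arc_verts[OF T ab'(1)] by (auto dest: inj_onD)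
    then show ?thesis using tree_parent_unique[OF T ab(1), of a'] ab ab' by simp
  qed
  show "(troot (relabel f T), v) \<in> (tarcs (relabel f T))\<^sup>*" if v: "v \<in> tverts (relabel f T)" for v
  proof -
    obtain a where a: "v = f a" "a \<in> tverts T" using v by auto
    have "(f (troot T), f a) \<in> (tarcs (relabel f T))\<^sup>*" using tree_reach[OF T a(2)]
    proof (induction rule: rtrancl_induct)
      case (step y z)
      then have "(f y, f z) \<in> tarcs (relabel f T)" by force
      then show ?case using step.IH by (rule rtrancl_into_rtrancl[rotated])
    qed simp
    then show ?thesis using a by simp
  qed
qed

lemma leaf_isomorphism_relabel:
  assumes T: "rooted_tree T" and f: "inj_on f (tverts T)" and l: "\<And>v. v \<in> leaves T \<Longrightarrow> lab' (f v) = lab v"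
  shows "leaf_isomorphism f (T, lab) (relabel f T, lab')"
  unfolding leaf_isomorphism_def using relabel_arcs[OF T f] f l
  by (simp add: inj_on_imp_bij_betw adjacent_def del: relabel_simps(3))

lemma relabel_leaf_isomorphism:
  assumes X: "rooted_tree (fst X)" and Y: "rooted_tree (fst Y)" and i: "leaf_isomorphism \<phi> X Y"
  shows "relabel \<phi> (fst X) = fst Y"
proof (rule rtree_eqI)
  have b: "\<phi> ` tverts (fst X) = tverts (fst Y)" and r: "\<phi> (troot (fst X)) = troot (fst Y)"
    using i unfolding leaf_isomorphism_def bij_betw_def by auto
  show "tverts (relabel \<phi> (fst X)) = tverts (fst Y)" "troot (relabel \<phi> (fst X)) = troot (fst Y)"
    using b r by simp_all
  show "tarcs (relabel \<phi> (fst X)) = tarcs (fst Y)"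
  proof
    show "tarcs (relabel \<phi> (fst X)) \<subseteq> tarcs (fst Y)"
      using leaf_isomorphism_arcs[OF X Y i] tree_arc_verts[OF X] by auto
    show "tarcs (fst Y) \<subseteq> tarcs (relabel \<phi> (fst X))"
    proof
      fix e assume e: "e \<in> tarcs (fst Y)"
      obtain a b where ab: "e = (a, b)" by (cases e)
      then have "a \<in> \<phi> ` tverts (fst X)" "b \<in> \<phi> ` tverts (fst X)" using tree_arc_verts[OF Y] e b by auto
      then obtain u v where uv: "a = \<phi> u" "b = \<phi> v" "u \<in> tverts (fst X)" "v \<in> tverts (fst X)" by blast
      then have "(u, v) \<in> tarcs (fst X)" using leaf_isomorphism_arcs[OF X Y i] e ab by blast
      then show "e \<in> tarcs (relabel \<phi> (fst X))" using ab uv by force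
    qed
  qed
qed

section \<open>Forgetting the labels of the internal nodes\<close>

primrec node_map :: "(nat \<Rightarrow> nat) \<Rightarrow> vertex \<Rightarrow> vertex" where
  "node_map \<pi> (Node i) = Node (\<pi> i)"
| "node_map \<pi> (Leaf i) = Leaf i"

context
  fixes d m :: nat
  assumes d: "1 \<le> d"
begin

abbreviation "dary_labeled \<equiv> labeled_trees (replicate m d)"

lemma num_leaves_replicate: "num_leaves (replicate m d) = 1 + m * (d - 1)"
  unfolding num_leaves_def by (simp add: sum_list_replicate)

lemma dary_labeled_leaves:
  assumes T: "T \<in> dary_labeled"
  shows "leaves T = Leaf ` {1..1 + m * (d - 1)}" "nonleaves T = Node ` {1..m}"
    "tverts T = Node ` {1..m} \<union> Leaf ` {1..1 + m * (d - 1)}"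
  using labeled_trees_leaves[OF T] labeled_treesD(2)[OF T] d num_leaves_replicate by auto

lemma dary_labeled_representative:
  assumes T: "T \<in> dary_labeled"
  shows "(T, leaf_index) \<in> dary_representatives d m"
  unfolding dary_representatives_def dary_labeled_leaves[OF T] split mem_Collect_eq
proof (intro conjI ballI)
  show "rooted_tree T" using labeled_treesD(1)[OF T] .
  show "card (Node ` {1..m}) = m" by (subst card_image) (auto simp: inj_on_def)
  show "card (children T v) = d" if "v \<in> Node ` {1..m}" for v
  proof -
    obtain i where "v = Node i" "i \<in> {1..m}" using \<open>v \<in> Node ` {1..m}\<close> by blast
    then show ?thesis using labeled_treesD(3)[OF T, of i] by auto
  qed
  show "bij_betw leaf_index (Leaf ` {1..1 + m * (d - 1)}) {1..1 + m * (d - 1)}"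
    by (auto simp: bij_betw_def inj_on_def image_image)
qed

text \<open>Serves twice: for naming the vertices of an arbitrary representative, and for permuting
  the internal labels of a labeled tree.\<close>

lemma representative_relabel_mem:
  assumes X: "(T, lab) \<in> dary_representatives d m" and f: "inj_on f (tverts T)"
    and l: "\<And>v. v \<in> leaves T \<Longrightarrow> f v = Leaf (lab v)" and n: "f ` nonleaves T = Node ` {1..m}"
  shows "relabel f T \<in> dary_labeled" "leaf_isomorphism f (T, lab) (relabel f T, leaf_index)"
proof -
  have T: "rooted_tree T" and dc: "\<And>v. v \<in> nonleaves T \<Longrightarrow> card (children T v) = d"
    and lb: "bij_betw lab (leaves T) {1..1 + m * (d - 1)}"
    using X unfolding dary_representatives_def by auto
  show i: "leaf_isomorphism f (T, lab) (relabel f T, leaf_index)"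
    using l by (intro leaf_isomorphism_relabel[OF T f]) simp
  have R: "rooted_tree (relabel f T)" using rooted_tree_relabel[OF T f] .
  have ch: "children (relabel f T) (f u) = f ` children T u" if "u \<in> tverts T" for u
    using leaf_isomorphism_children[of "(T, lab)" "(relabel f T, leaf_index)" f u] T R i that by simp
  have "f ` leaves T = Leaf ` lab ` leaves T" using l by (auto simp: image_image)
  also have "\<dots> = Leaf ` {1..num_leaves (replicate m d)}"
    using lb unfolding bij_betw_def num_leaves_replicate by simp
  finally have fl: "f ` leaves T = Leaf ` {1..num_leaves (replicate m d)}" .
  have "tverts T = nonleaves T \<union> leaves T" unfolding leaves_def nonleaves_def by auto
  then have "f ` tverts T = Node ` {1..m} \<union> Leaf ` {1..num_leaves (replicate m d)}"
    using n fl by (simp add: image_Un)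
  moreover have "card (children (relabel f T) (Node i)) = d" if i: "i \<in> {1..m}" for i
  proof -
    have "Node i \<in> f ` nonleaves T" using i n by blast
    then obtain v where v: "v \<in> nonleaves T" "f v = Node i" by auto
    then have "v \<in> tverts T" unfolding nonleaves_def by blast
    then have "card (children (relabel f T) (Node i)) = card (f ` children T v)" using ch v by metis
    also have "\<dots> = card (children T v)"
      by (rule card_image) (rule inj_on_subset[OF f children_verts[OF T]])
    finally show ?thesis using dc[OF v(1)] by simp
  qed
  moreover have "children (relabel f T) (Leaf i) = {}" if i: "i \<in> {1..num_leaves (replicate m d)}" for i
  proof -
    have "Leaf i \<in> f ` leaves T" using i fl by blast
    then obtain v where v: "v \<in> leaves T" "f v = Leaf i" by auto
    then show ?thesis using ch[of v] unfolding leaves_def by auto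
  qed
  ultimately show "relabel f T \<in> dary_labeled" unfolding labeled_trees_def using R by auto
qed

lemma representative_has_labeled_tree:
  assumes X: "X \<in> dary_representatives d m"
  shows "\<exists>T \<phi>. T \<in> dary_labeled \<and> leaf_isomorphism \<phi> (T, leaf_index) X"
proof -
  obtain U lab where U: "X = (U, lab)" by (cases X)
  have T: "rooted_tree U" and c: "card (nonleaves U) = m" and lb: "inj_on lab (leaves U)"
    using X unfolding U dary_representatives_def bij_betw_def by auto
  have "finite (nonleaves U)" using tree_finite[OF T] unfolding nonleaves_def by simp
  then obtain \<beta> where \<beta>: "bij_betw \<beta> (nonleaves U) {1..m}"
    using finite_same_card_bij[of "nonleaves U" "{1..m}"] c by auto
  \<comment> \<open>Leaf names are forced by the labels; the internal vertices may be enumerated in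
    any way.\<close>
  define f where "f v = (if v \<in> leaves U then Leaf (lab v) else Node (\<beta> v))" for v
  have disj: "v \<in> nonleaves U \<longleftrightarrow> v \<notin> leaves U" if "v \<in> tverts U" for v
    using that unfolding leaves_def nonleaves_def by auto
  have f: "inj_on f (tverts U)"
    using lb \<beta> disj unfolding f_def inj_on_def bij_betw_def by auto
  have "f ` nonleaves U = Node ` \<beta> ` nonleaves U"
    using disj unfolding f_def by (force simp: nonleaves_def)
  then have n: "f ` nonleaves U = Node ` {1..m}" using \<beta> unfolding bij_betw_def by simp
  have l: "f v = Leaf (lab v)" if "v \<in> leaves U" for v using that unfolding f_def by simp
  note r = representative_relabel_mem[OF X[unfolded U] f l n]
  have "leaf_isomorphism (inv_into (tverts (fst (U, lab))) f) (relabel f U, leaf_index) (U, lab)"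
    by (rule leaf_isomorphism_inv[OF _ _ r(2)]) (use T rooted_tree_relabel[OF T f] in simp_all)
  then show ?thesis using r(1) U by blast
qed

lemma relabel_node_map:
  assumes T: "T \<in> dary_labeled" and p: "\<pi> permutes {1..m}"
  shows "relabel (node_map \<pi>) T \<in> dary_labeled"
    and "leaf_isomorphism (node_map \<pi>) (T, leaf_index) (relabel (node_map \<pi>) T, leaf_index)"
proof -
  have "inj (node_map \<pi>)"
  proof (rule injI)
    fix u v assume "node_map \<pi> u = node_map \<pi> v"
    then show "u = v" using permutes_inj[OF p] by (cases u; cases v) (auto dest: injD)
  qed
  then have f: "inj_on (node_map \<pi>) (tverts T)" by (rule inj_on_subset) simp
  have l: "node_map \<pi> v = Leaf (leaf_index v)" if "v \<in> leaves T" for v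
    using that dary_labeled_leaves(1)[OF T] by auto
  have "node_map \<pi> ` nonleaves T = Node ` \<pi> ` {1..m}"
    unfolding dary_labeled_leaves(2)[OF T] by (simp add: image_image)
  then have n: "node_map \<pi> ` nonleaves T = Node ` {1..m}" using permutes_image[OF p] by simp
  show "relabel (node_map \<pi>) T \<in> dary_labeled"
    "leaf_isomorphism (node_map \<pi>) (T, leaf_index) (relabel (node_map \<pi>) T, leaf_index)"
    using representative_relabel_mem[OF dary_labeled_representative[OF T] f l n] by auto
qed

text \<open>Between labeled trees an isomorphism fixes each leaf by its label and sends internal
  nodes to internal nodes, so it can only permute the latter.\<close>

lemma leaf_isomorphism_dary_labeled_node_map:
  assumes T: "T \<in> dary_labeled" and S: "S \<in> dary_labeled" and i: "leaf_isomorphism \<psi> (T, leaf_index) (S, leaf_index)"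
  shows "\<exists>\<pi>. \<pi> permutes {1..m} \<and> S = relabel (node_map \<pi>) T"
proof -
  note RT = labeled_treesD(1)[OF T] and RS = labeled_treesD(1)[OF S]
  have inj: "inj_on \<psi> (tverts T)" and im: "\<psi> ` tverts T = tverts S"
    and li: "\<And>v. v \<in> leaves T \<Longrightarrow> leaf_index (\<psi> v) = leaf_index v"
    using i unfolding leaf_isomorphism_def bij_betw_def by auto
  have lv: "\<psi> u \<in> leaves S \<longleftrightarrow> u \<in> leaves T" "\<psi> u \<in> nonleaves S \<longleftrightarrow> u \<in> nonleaves T" if "u \<in> tverts T" for u
    using leaf_isomorphism_leaves[of "(T, leaf_index)" "(S, leaf_index)" \<psi> u] RT RS i that by auto
  \<comment> \<open>The identity outside \<open>{1..m}\<close>, as \<open>permutes\<close>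
    demands.\<close>
  define \<pi> where "\<pi> k = (if k \<in> {1..m} then (THE j. \<psi> (Node k) = Node j) else k)" for k
  have node: "\<psi> (Node k) = Node (\<pi> k) \<and> \<pi> k \<in> {1..m}" if k: "k \<in> {1..m}" for k
  proof -
    have "\<psi> (Node k) \<in> nonleaves S" using lv(2)[of "Node k"] k dary_labeled_leaves(2,3)[OF T] by auto
    then obtain j where "\<psi> (Node k) = Node j" "j \<in> {1..m}" unfolding dary_labeled_leaves(2)[OF S] by auto
    then show ?thesis using k unfolding \<pi>_def by auto
  qed
  have "inj_on \<pi> {1..m}"
  proof (rule inj_onI)
    fix a b assume ab: "a \<in> {1..m}" "b \<in> {1..m}" "\<pi> a = \<pi> b"
    then have "\<psi> (Node a) = \<psi> (Node b)" using node[OF ab(1)] node[OF ab(2)] by simp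
    moreover have "Node a \<in> tverts T" "Node b \<in> tverts T"
      using ab(1,2) unfolding dary_labeled_leaves(3)[OF T] by blast+
    ultimately have "Node a = Node b" by (rule inj_onD[OF inj])
    then show "a = b" by simp
  qed
  moreover have "\<pi> ` {1..m} \<subseteq> {1..m}" using node by blast
  ultimately have "bij_betw \<pi> {1..m} {1..m}"
    by (simp add: bij_betw_def endo_inj_surj)
  then have p: "\<pi> permutes {1..m}" by (rule bij_imp_permutes) (unfold \<pi>_def, rule if_not_P)
  have eq: "\<psi> v = node_map \<pi> v" if v: "v \<in> tverts T" for v
  proof (cases v)
    case (Node k)
    then show ?thesis using v node[of k] dary_labeled_leaves(3)[OF T] by auto
  next
    case (Leaf k)
    then have vl: "v \<in> leaves T" using v dary_labeled_leaves[OF T] by auto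
    then obtain j where "\<psi> v = Leaf j" using lv(1)[OF v] dary_labeled_leaves(1)[OF S] by auto
    then show ?thesis using li[OF vl] Leaf by simp
  qed
  have "S = relabel \<psi> T"
    using relabel_leaf_isomorphism[of "(T, leaf_index)" "(S, leaf_index)" \<psi>] RT RS i by simp
  also have "\<dots> = relabel (node_map \<pi>) T"
    unfolding relabel_def using eq tree_root[OF RT] tree_arc_verts[OF RT]
    by (intro rtree_eqI) (auto intro!: image_cong)
  finally show ?thesis using p by blast
qed

text \<open>The permutations act simply transitively on the labelings of one leaf-labeled tree:
  rigidity makes the action free, and composing isomorphisms through \<open>X\<close> makes it
  transitive.\<close>

lemma fibre_bij:
  assumes X: "X \<in> dary_representatives d m" and T: "T \<in> dary_labeled"
    and i: "leaf_isomorphism \<phi> (T, leaf_index) X"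
  shows "bij_betw (\<lambda>\<pi>. relabel (node_map \<pi>) T) {\<pi>. \<pi> permutes {1..m}}
    {S \<in> dary_labeled. \<exists>\<psi>. leaf_isomorphism \<psi> (S, leaf_index) X}"
proof (rule bij_betw_imageI)
  note RT = labeled_treesD(1)[OF T] and RX = dary_representatives_rooted[OF X]
  show "inj_on (\<lambda>\<pi>. relabel (node_map \<pi>) T) {\<pi>. \<pi> permutes {1..m}}"
  proof (rule inj_onI, clarify)
    fix \<pi> \<rho> assume p: "\<pi> permutes {1..m}" "\<rho> permutes {1..m}"
      and eq: "relabel (node_map \<pi>) T = relabel (node_map \<rho>) T"
    note r1 = relabel_node_map[OF T p(1)]
    note r2 = relabel_node_map[OF T p(2), folded eq]
    note rr = dary_labeled_representative[OF r1(1)]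
    have "node_map \<pi> v = node_map \<rho> v" if "v \<in> tverts T" for v
      using leaf_isomorphism_unique[OF _ dary_representatives_rooted[OF rr]
          dary_representatives_inj[OF rr] r1(2) r2(2), of v] RT that by simp
    then have "\<pi> k = \<rho> k" if "k \<in> {1..m}" for k
      using that dary_labeled_leaves(3)[OF T] by (metis UnI1 imageI node_map.simps(1) vertex.inject(1))
    then show "\<pi> = \<rho>" using p unfolding permutes_def by (metis ext)
  qed
  show "(\<lambda>\<pi>. relabel (node_map \<pi>) T) ` {\<pi>. \<pi> permutes {1..m}} =
    {S \<in> dary_labeled. \<exists>\<psi>. leaf_isomorphism \<psi> (S, leaf_index) X}"
  proof (intro set_eqI iffI)
    fix S assume "S \<in> (\<lambda>\<pi>. relabel (node_map \<pi>) T) ` {\<pi>. \<pi> permutes {1..m}}"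
    then obtain \<pi> where p: "\<pi> permutes {1..m}" "S = relabel (node_map \<pi>) T" by blast
    note r = relabel_node_map[OF T p(1), folded p(2)]
    have RS: "rooted_tree S" using labeled_treesD(1)[OF r(1)] .
    have "leaf_isomorphism (inv_into (tverts (fst (T, leaf_index))) (node_map \<pi>)) (S, leaf_index) (T, leaf_index)"
      using RS RT by (intro leaf_isomorphism_inv[OF _ _ r(2)]) simp_all
    then have "\<exists>\<psi>. leaf_isomorphism \<psi> (S, leaf_index) X"
      using leaf_isomorphism_comp[of "(S, leaf_index)" "(T, leaf_index)" _ \<phi> X] RS RT i by auto
    then show "S \<in> {S \<in> dary_labeled. \<exists>\<psi>. leaf_isomorphism \<psi> (S, leaf_index) X}" using r(1) by blast
  next
    fix S assume "S \<in> {S \<in> dary_labeled. \<exists>\<psi>. leaf_isomorphism \<psi> (S, leaf_index) X}"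
    then obtain \<psi> where S: "S \<in> dary_labeled" and j: "leaf_isomorphism \<psi> (S, leaf_index) X" by blast
    have RS: "rooted_tree S" using labeled_treesD(1)[OF S] .
    have "leaf_isomorphism (inv_into (tverts (fst (S, leaf_index))) \<psi>) X (S, leaf_index)"
      using RS RX by (intro leaf_isomorphism_inv[OF _ _ j]) simp_all
    then have "leaf_isomorphism (inv_into (tverts (fst (S, leaf_index))) \<psi> \<circ> \<phi>) (T, leaf_index) (S, leaf_index)"
      using RT RX by (intro leaf_isomorphism_comp[OF _ _ i]) simp_all
    then obtain \<pi> where "\<pi> permutes {1..m}" "S = relabel (node_map \<pi>) T"
      using leaf_isomorphism_dary_labeled_node_map[OF T S] by blast
    then show "S \<in> (\<lambda>\<pi>. relabel (node_map \<pi>) T) ` {\<pi>. \<pi> permutes {1..m}}" by blast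
  qed
qed

section \<open>Fibre sizes and the law of the tree without internal labels\<close>

lemma card_fibre:
  assumes X: "X \<in> dary_representatives d m"
  shows "card {S \<in> dary_labeled. \<exists>\<psi>. leaf_isomorphism \<psi> (S, leaf_index) X} = fact m"
proof -
  obtain T \<phi> where T: "T \<in> dary_labeled" "leaf_isomorphism \<phi> (T, leaf_index) X"
    using representative_has_labeled_tree[OF X] by blast
  show ?thesis
    using bij_betw_same_card[OF fibre_bij[OF X T]] card_permutations[of "{1..m}" m] by simp
qed

lemma forget_labels_eq_iff:
  assumes C: "C \<in> leaf_labeled_dary_trees d m" and X: "X \<in> C" and T: "T \<in> dary_labeled"
  shows "forget_labels d m T = C \<longleftrightarrow> (\<exists>\<psi>. leaf_isomorphism \<psi> (T, leaf_index) X)"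
proof -
  note eq = equiv_leaf_iso_rel[of d m]
  have XR: "X \<in> dary_representatives d m"
    using C X in_quotient_imp_subset[OF eq] unfolding leaf_labeled_dary_trees_def by blast
  obtain Y where Y: "C = leaf_iso_rel d m `` {Y}"
    using C unfolding leaf_labeled_dary_trees_def by (rule quotientE)
  then have "(Y, X) \<in> leaf_iso_rel d m" using X by simp
  then have "C = leaf_iso_rel d m `` {X}" unfolding Y by (rule equiv_class_eq[OF eq])
  then have "forget_labels d m T = C \<longleftrightarrow> ((T, leaf_index), X) \<in> leaf_iso_rel d m"
    unfolding forget_labels_def using eq_equiv_class_iff[OF eq dary_labeled_representative[OF T] XR] by simp
  then show ?thesis using XR dary_labeled_representative[OF T] unfolding leaf_iso_rel_def by simp
qed

lemma class_member_representative:
  assumes "C \<in> leaf_labeled_dary_trees d m" "X \<in> C"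
  shows "X \<in> dary_representatives d m"
  using assms in_quotient_imp_subset[OF equiv_leaf_iso_rel[of d m]] unfolding leaf_labeled_dary_trees_def by blast

lemma class_nonempty: "C \<in> leaf_labeled_dary_trees d m \<Longrightarrow> \<exists>X. X \<in> C"
  using in_quotient_imp_non_empty[OF equiv_leaf_iso_rel[of d m]] unfolding leaf_labeled_dary_trees_def by blast

lemma card_forget_fibre:
  assumes C: "C \<in> leaf_labeled_dary_trees d m"
  shows "card {T \<in> dary_labeled. forget_labels d m T = C} = fact m"
proof -
  obtain X where X: "X \<in> C" using class_nonempty[OF C] by blast
  have "{T \<in> dary_labeled. forget_labels d m T = C} = {S \<in> dary_labeled. \<exists>\<psi>. leaf_isomorphism \<psi> (S, leaf_index) X}"
    using forget_labels_eq_iff[OF C X] by blast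
  then show ?thesis using card_fibre[OF class_member_representative[OF C X]] by simp
qed

lemma forget_labels_image: "forget_labels d m ` dary_labeled = leaf_labeled_dary_trees d m"
proof
  show "forget_labels d m ` dary_labeled \<subseteq> leaf_labeled_dary_trees d m"
    unfolding forget_labels_def leaf_labeled_dary_trees_def using dary_labeled_representative by (auto intro: quotientI)
  show "leaf_labeled_dary_trees d m \<subseteq> forget_labels d m ` dary_labeled"
  proof
    fix C assume "C \<in> leaf_labeled_dary_trees d m"
    then have "card {T \<in> dary_labeled. forget_labels d m T = C} \<noteq> 0" using card_forget_fibre by simp
    then show "C \<in> forget_labels d m ` dary_labeled" by (auto simp: card_eq_0_iff)
  qed
qed

lemma map_forget_labels_uniform:
  assumes ne: "dary_labeled \<noteq> {}"
  shows "map_pmf (forget_labels d m) (pmf_of_set dary_labeled) = pmf_of_set (leaf_labeled_dary_trees d m)"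
proof -
  let ?C = "leaf_labeled_dary_trees d m"
  let ?p = "map_pmf (forget_labels d m) (pmf_of_set dary_labeled)"
  have fin: "finite ?C" "?C \<noteq> {}" unfolding forget_labels_image[symmetric] using finite_labeled_trees ne by auto
  have sup: "set_pmf ?p = ?C" using finite_labeled_trees ne forget_labels_image by simp
  \<comment> \<open>All fibres have \<open>fact m\<close> elements, so each class has this mass.
    Total mass one turns it into the reciprocal of the number of classes; the labeled trees
    themselves are never counted.\<close>
  define c where "c = fact m / real (card dary_labeled)"
  have c: "pmf ?p C = c" if "C \<in> ?C" for C
  proof -
    have "dary_labeled \<inter> forget_labels d m -` {C} = {T \<in> dary_labeled. forget_labels d m T = C}" by auto
    then show ?thesis
      using card_forget_fibre[OF that] ne finite_labeled_trees
      by (simp add: pmf_map measure_pmf_of_set c_def)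
  qed
  have "sum (pmf ?p) ?C = 1" using fin(1) sup by (intro sum_pmf_eq_1) auto
  then have "real (card ?C) * c = 1" using c by simp
  then have "c = 1 / card ?C" using fin by (simp add: field_simps)
  show ?thesis
  proof (rule pmf_eqI)
    fix C
    show "pmf ?p C = pmf (pmf_of_set ?C) C"
    proof (cases "C \<in> ?C")
      case True
      then show ?thesis using c \<open>c = 1 / card ?C\<close> fin by simp
    next
      case False
      then have "pmf ?p C = 0" using sup by (metis pmf_eq_0_set_pmf)
      then show ?thesis using False fin by simp
    qed
  qed
qed

end

text \<open>Composition with the transposition of \<open>k\<close> and \<open>Suc m\<close>, its own
  inverse, makes \<open>Suc m\<close> a fixed point and leaves a permutation of
  \<open>{1..m}\<close>.\<close>

lemma card_permutes_with_value:
  assumes k: "k \<in> {1..Suc m}"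
  shows "card {\<pi>. \<pi> permutes {1..Suc m} \<and> \<pi> k = Suc m} = fact m"
proof -
  let ?t = "Transposition.transpose k (Suc m)"
  have t: "?t permutes {1..Suc m}" using k by (intro permutes_swap_id) auto
  have "bij_betw (\<lambda>\<pi>. \<pi> \<circ> ?t) {\<pi>. \<pi> permutes {1..m}} {\<pi>. \<pi> permutes {1..Suc m} \<and> \<pi> k = Suc m}"
  proof (rule bij_betwI[where g = "\<lambda>\<pi>. \<pi> \<circ> ?t"])
    show "(\<lambda>\<pi>. \<pi> \<circ> ?t) \<in> {\<pi>. \<pi> permutes {1..m}} \<rightarrow> {\<pi>. \<pi> permutes {1..Suc m} \<and> \<pi> k = Suc m}"
    proof (rule funcsetI, clarify, intro conjI)
      fix \<pi> assume p: "\<pi> permutes {1..m}"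
      then have "\<pi> permutes {1..Suc m}" by (rule permutes_subset) auto
      then show "\<pi> \<circ> ?t permutes {1..Suc m}" using t permutes_compose by blast
      show "(\<pi> \<circ> ?t) k = Suc m" using permutes_not_in[OF p, of "Suc m"] by simp
    qed
    show "(\<lambda>\<pi>. \<pi> \<circ> ?t) \<in> {\<pi>. \<pi> permutes {1..Suc m} \<and> \<pi> k = Suc m} \<rightarrow> {\<pi>. \<pi> permutes {1..m}}"
    proof (rule funcsetI, clarify)
      fix \<pi> assume p: "\<pi> permutes {1..Suc m}" "\<pi> k = Suc m"
      have "\<pi> \<circ> ?t permutes {1..Suc m}" using t p(1) permutes_compose by blast
      then show "\<pi> \<circ> ?t permutes {1..m}"
        by (rule permutes_superset) (use p(2) in \<open>auto simp: le_Suc_eq\<close>)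
    qed
  qed (auto simp: comp_assoc)
  then show ?thesis using bij_betw_same_card card_permutations[of "{1..m}" m] by fastforce
qed

lemma card_fibre_new_node:
  assumes d: "1 \<le> d" and X: "X \<in> dary_representatives d (Suc m)" and v: "v \<in> nonleaves (fst X)"
  shows "card {S \<in> labeled_trees (replicate (Suc m) d).
      \<exists>\<psi>. leaf_isomorphism \<psi> (S, leaf_index) X \<and> \<psi> (Node (Suc m)) = v} = fact m"
proof -
  let ?A = "labeled_trees (replicate (Suc m) d)"
  obtain T \<phi> where T: "T \<in> ?A" and i: "leaf_isomorphism \<phi> (T, leaf_index) X"
    using representative_has_labeled_tree[OF d X] by blast
  note RT = labeled_treesD(1)[OF T] and RX = dary_representatives_rooted[OF X]
  note Lv = dary_labeled_leaves[OF d T]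
  have "v \<in> tverts (fst X)" using v unfolding nonleaves_def by blast
  moreover have "\<phi> ` tverts T = tverts (fst X)" using i unfolding leaf_isomorphism_def bij_betw_def by simp
  ultimately have "v \<in> \<phi> ` tverts T" by simp
  then obtain u where u: "u \<in> tverts T" "\<phi> u = v" by (elim imageE) simp
  then have "u \<in> nonleaves T"
    using leaf_isomorphism_leaves(2)[of "(T, leaf_index)" X \<phi> u] RT RX i v by simp
  then obtain k where k: "k \<in> {1..Suc m}" "u = Node k" using Lv(2) by auto
  note bij = fibre_bij[OF d X T i]
  let ?g = "\<lambda>\<pi>. relabel (node_map \<pi>) T"
  have key: "(\<exists>\<psi>. leaf_isomorphism \<psi> (?g \<pi>, leaf_index) X \<and> \<psi> (Node (Suc m)) = v) \<longleftrightarrow> \<pi> k = Suc m"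
    if p: "\<pi> permutes {1..Suc m}" for \<pi>
  proof -
    note r = relabel_node_map[OF d T p]
    have RS: "rooted_tree (?g \<pi>)" using labeled_treesD(1)[OF r(1)] .
    obtain \<psi>0 where \<psi>0: "leaf_isomorphism \<psi>0 (?g \<pi>, leaf_index) X"
      using bij_betwE[OF bij] p by blast
    \<comment> \<open>By rigidity \<open>\<psi>\<close> after the relabeling equals
      \<open>\<phi>\<close>, so \<open>\<psi>\<close> sends \<open>Node (\<pi> k)\<close> to
      \<open>v\<close>. Every isomorphism thus gives the same answer, and the existential over
      \<open>\<psi>\<close> is harmless.\<close>
    have iff: "\<psi> (Node (Suc m)) = v \<longleftrightarrow> \<pi> k = Suc m" if j: "leaf_isomorphism \<psi> (?g \<pi>, leaf_index) X" for \<psi>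
    proof -
      have "leaf_isomorphism (\<psi> \<circ> node_map \<pi>) (T, leaf_index) X"
        using RT RS by (intro leaf_isomorphism_comp[OF _ _ r(2) j]) simp_all
      then have "(\<psi> \<circ> node_map \<pi>) u = \<phi> u"
        using leaf_isomorphism_unique[OF _ RX dary_representatives_inj[OF X] _ i] RT u(1) by simp
      then have "\<psi> (Node (\<pi> k)) = v" using k(2) u(2) by simp
      moreover have "inj_on \<psi> (tverts (?g \<pi>))" using j unfolding leaf_isomorphism_def bij_betw_def by simp
      moreover have "Node (\<pi> k) \<in> tverts (?g \<pi>)" "Node (Suc m) \<in> tverts (?g \<pi>)"
        unfolding dary_labeled_leaves(3)[OF d r(1)] using permutes_in_image[OF p, of k] k(1) by auto
      ultimately show ?thesis by (metis inj_onD vertex.inject(1))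
    qed
    then show ?thesis using \<psi>0 by blast
  qed
  have eq: "{S \<in> ?A. \<exists>\<psi>. leaf_isomorphism \<psi> (S, leaf_index) X \<and> \<psi> (Node (Suc m)) = v} =
      ?g ` {\<pi>. \<pi> permutes {1..Suc m} \<and> \<pi> k = Suc m}" (is "?L = ?R")
  proof
    show "?L \<subseteq> ?R"
    proof
      fix S assume S: "S \<in> ?L"
      then have "S \<in> {S \<in> ?A. \<exists>\<psi>. leaf_isomorphism \<psi> (S, leaf_index) X}" by blast
      then obtain \<pi> where p: "\<pi> permutes {1..Suc m}" "S = ?g \<pi>"
        using bij unfolding bij_betw_def by blast
      then have "\<pi> k = Suc m" using key[OF p(1)] S by blast
      then show "S \<in> ?R" using p by blast
    qed
    show "?R \<subseteq> ?L" using key relabel_node_map(1)[OF d T] by auto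
  qed
  have inj: "inj_on ?g {\<pi>. \<pi> permutes {1..Suc m} \<and> \<pi> k = Suc m}"
    using bij_betw_imp_inj_on[OF bij] by (rule inj_on_subset) auto
  show ?thesis unfolding eq card_image[OF inj] by (rule card_permutes_with_value[OF k(1)])
qed

text \<open>An isomorphism class has vertices only through its representatives, so (ii) fixes
  \<open>X\<close> in the class \<open>C\<close> and a vertex of \<open>X\<close>. The event says
  that the isomorphism from the labeled tree onto \<open>X\<close>, unique by rigidity, sends the
  newest node to that vertex.\<close>

theorem mainTheorem2:
  fixes d m :: nat
  assumes "d \<ge> 1" and "m \<ge> 1"
  shows "map_pmf (forget_labels d m) (growth_law d m) =
           pmf_of_set (leaf_labeled_dary_trees d m) \<and>
         (\<forall>C \<in> leaf_labeled_dary_trees d (m + 1). \<forall>X \<in> C. \<forall>v \<in> nonleaves (fst X).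
            cond_prob (measure_pmf (growth_law d (m + 1)))
              (\<lambda>T. \<exists>\<phi>. leaf_isomorphism \<phi> (T, leaf_index) X \<and> \<phi> (Node (m + 1)) = v)
              (\<lambda>T. forget_labels d (m + 1) T = C)
            = 1 / real (card (nonleaves (fst X))))"
proof (intro conjI ballI)
  obtain n where n: "m = Suc n" using assms(2) by (cases m) auto
  show "map_pmf (forget_labels d m) (growth_law d m) = pmf_of_set (leaf_labeled_dary_trees d m)"
    using growth_law_eq_pmf_of_set[OF assms(1), of n] map_forget_labels_uniform[OF assms(1), of m] n by simp
  fix C X v assume C: "C \<in> leaf_labeled_dary_trees d (m + 1)" and X: "X \<in> C" and v: "v \<in> nonleaves (fst X)"
  let ?A = "labeled_trees (replicate (Suc m) d)"
  have A: "growth_law d (m + 1) = pmf_of_set ?A" "?A \<noteq> {}" "finite ?A"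
    using growth_law_eq_pmf_of_set[OF assms(1), of m] finite_labeled_trees by auto
  have XR: "X \<in> dary_representatives d (Suc m)"
    using class_member_representative[OF assms(1) C X] by simp
  \<comment> \<open>An isomorphism onto \<open>X\<close> already puts the tree into the class
    \<open>C\<close>, so the joint event is the fibre with the newest node at
    \<open>v\<close>.\<close>
  have "?A \<inter> {T. (\<exists>\<phi>. leaf_isomorphism \<phi> (T, leaf_index) X \<and> \<phi> (Node (m + 1)) = v) \<and>
      forget_labels d (m + 1) T = C} =
    {S \<in> ?A. \<exists>\<psi>. leaf_isomorphism \<psi> (S, leaf_index) X \<and> \<psi> (Node (Suc m)) = v}"
    using forget_labels_eq_iff[OF assms(1) C X] by auto
  then have c1: "card (?A \<inter> {T. (\<exists>\<phi>. leaf_isomorphism \<phi> (T, leaf_index) X \<and> \<phi> (Node (m + 1)) = v) \<and>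
      forget_labels d (m + 1) T = C}) = fact m"
    using card_fibre_new_node[OF assms(1) XR v] by simp
  have "?A \<inter> {T. forget_labels d (m + 1) T = C} = {T \<in> ?A. forget_labels d (Suc m) T = C}" by auto
  then have c2: "card (?A \<inter> {T. forget_labels d (m + 1) T = C}) = Suc m * fact m"
    using card_forget_fibre[OF assms(1), of C "Suc m"] C by simp
  \<comment> \<open>Both probabilities are fractions of \<open>card ?A\<close>, which cancels; what
    remains is \<open>fact m\<close> divided by \<open>Suc m * fact m\<close>.\<close>
  have c0: "card ?A > 0" using A by (simp add: card_gt_0_iff)
  have c3: "card (nonleaves (fst X)) = Suc m" using XR unfolding dary_representatives_def by auto
  show "cond_prob (measure_pmf (growth_law d (m + 1)))
      (\<lambda>T. \<exists>\<phi>. leaf_isomorphism \<phi> (T, leaf_index) X \<and> \<phi> (Node (m + 1)) = v)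
      (\<lambda>T. forget_labels d (m + 1) T = C) = 1 / real (card (nonleaves (fst X)))"
    using c0 unfolding cond_prob_def A(1) space_measure_pmf c3
    by (simp add: measure_pmf_of_set[OF A(2,3)] c1[unfolded Suc_eq_plus1[symmetric]] c2[unfolded Suc_eq_plus1[symmetric]] del: of_nat_Suc replicate_Suc mult_Suc)
qed

end
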